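(* Assume that the moving boundary is non-increasing ($A_t\subset A_s$ for $s\le t$) with $A_\infty:=\bigcap_{t\in I}A_t\neq\emptyset$, and that Assumptions (A'), $(H_{hom})$, $(H_\infty)$ and $(H'_\infty)$ stated in the context hold. Then for every $\mu\in\mathcal M_1(E_0)$, $$\mathbb P_\mu(X_t\in\cdot\mid\tau_A>t)\longrightarrow\alpha_\infty\quad\text{weakly as }t\to\infty,$$ where $\alpha_\infty$ is the quasi-stationary distribution given by $(H_\infty)$.
   Context: Let $I=\mathbb Z_+$ or $\mathbb R_+$. $(X_t)_{t\in I}$ is a time-homogeneous Markov process on a metric space $(E,d)$ equipped with a $\sigma$-algebra $\mathcal E$, and $\mathcal F_t=\sigma(X_u,\,0\le u\le t)$. For $s\in I$, $x\in E$, $\mathbb P_{s,x}$ is the law of the process started from $x$ at time $s$ ($\mathbb P_{s,x}(X_s=x)=1$; by time-homogeneity $(X_{s+u})_{u\in I}$ under $\mathbb P_{s,x}$ has the law of $(X_u)_{u\in I}$ under $\mathbb P_{0,x}$). Put $\mathbb P_{s,\mu}=\int\mathbb P_{s,x}\,\mu(dx)$, $\mathbb P_x=\mathbb P_{0,x}$, $\mathbb P_\mu=\mathbb P_{0,\mu}$, with expectations $\mathbb E_{s,x}$, etc. For $F\subset E$, $\mathcal M_1(F)$ is the set of probability measures on $F$. For each $t\in I$, $A_t\in\mathcal E$, $E_t=E\setminus A_t$, and $\tau_A=\inf\{t\in I: X_t\in A_t\}$ (under $\mathbb P_{s,\cdot}$ the infimum is over $t\ge s$). It is assumed throughout that $\tau_A$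 is an $(\mathcal F_t)$-stopping time, $\mathbb P_{s,x}(\tau_A<\infty)=1$ for all $s\in I$, $x\in E_s$, and $\mathbb P_{s,x}(\tau_A>t)>0$ for all $s\le t$, $x\in E_s$. Put $E_\infty=E\setminus A_\infty$ and $\tau_{A_\infty}=\inf\{t\ge0:X_t\in A_\infty\}$. The total variation distance is $\|\mu-\nu\|_{TV}=\sup\{|\mu(f)-\nu(f)|: f\text{ measurable},\ \|f\|_\infty\le1\}$. Assumption (A'): there exist $\nu_s\in\mathcal M_1(E_s)$ ($s\in I$) and $t_0\in I$, $t_0>0$, $c_1,c_2>0$ such that (A'1) for all $s\in I$, $x\in E_s$: $\mathbb P_{s,x}(X_{s+t_0}\in\cdot\mid\tau_A>s+t_0)\ge c_1\nu_{s+t_0}$; (A'2) for all $s\le t$, $x\in E_s$: $\mathbb P_{s,\nu_s}(\tau_A>t)\ge c_2\mathbb P_{s,x}(\tau_A>t)$. Assumption $(H_{hom})$: (a) strong Markov property: for any $(\mathcal F_t)$-stopping time $\tau$ and any $x\in E$, $\mathbb P_x((X_{\tau+t})_{t\in I}\in\cdot,\tau<\infty\mid\mathcal F_\tau)=\mathbf 1_{\tau<\infty}\mathbb P_{X_\tau}((X_t)_{t\in I}\in\cdot)$; (b) for any $x\in E_0$, $t\in I$, $\mathbb P_{s,x}(\tau_A>s+t)\to\mathbb P_x(\tau_{A_\infty}>t)$ as $s\to\infty$; (c) for any $x\in E_0$ and $s\ge0$, the functions $t\mapsto\mathbb P_{s,x}(\tau_A>t)$ and $t\mapsto\mathbb P_x(\tau_{A_\infty}>t)$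 are continuous. Assumption $(H_\infty)$: there exist a unique $\alpha_\infty\in\mathcal M_1(E_\infty)$ and constants $C_\infty,\gamma_\infty>0$ such that for any $\mu\in\mathcal M_1(E_\infty)$ and $t\ge0$, $\|\mathbb P_\mu(X_t\in\cdot\mid\tau_{A_\infty}>t)-\alpha_\infty\|_{TV}\le C_\infty e^{-\gamma_\infty t}$. Under $(H_\infty)$ it is known that there is $\lambda_\infty>0$ with $\mathbb P_{\alpha_\infty}(\tau_{A_\infty}>t)=e^{-\lambda_\infty t}$ for all $t\in I$, and a function $\eta_\infty$, positive on $E_\infty$ and vanishing on $A_\infty$, with $\eta_\infty(x)=\lim_{t\to\infty}e^{\lambda_\infty t}\mathbb P_x(\tau_{A_\infty}>t)$ for $x\in E_\infty$. Assumption $(H'_\infty)$: there exist $s_0\in I$ and $x_0\in E_{s_0}$ such that for any $s\ge s_0$, $\mathbb E_{s,x_0}[e^{\lambda_\infty\tau_A}\eta_\infty(X_{\tau_A})]<+\infty$, and $\lim_{s\to\infty}\mathbb E_{s,x_0}[e^{\lambda_\infty(\tau_A-s)}\eta_\infty(X_{\tau_A})]=0$. *)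

theory Defs
  imports "HOL-Probability.Probability"
begin

definition weakly_converges ::
    "'e::metric_space measure \<Rightarrow> ('t \<Rightarrow> 'e measure) \<Rightarrow> 'e measure \<Rightarrow> 't filter \<Rightarrow> bool" where
  \<comment> \<open>If the \<open>\<sigma>\<close>-algebra of \<open>E\<close> contains the Borel sets (e.g. equals them), the measurability
      condition is automatic and all bounded continuous functions are tested.\<close>
  "weakly_converges E Q L G \<longleftrightarrow>
    (\<forall>f :: 'e \<Rightarrow> real. continuous_on UNIV f \<and> bounded (range f) \<and> f \<in> borel_measurable E \<longrightarrow>
      ((\<lambda>t. \<integral>x. f x \<partial>Q t) \<longlongrightarrow> (\<integral>x. f x \<partial>L)) G)"

definition tv_dist :: "'e measure \<Rightarrow> 'e measure \<Rightarrow> 'e measure \<Rightarrow> real" where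
  \<comment> \<open>Test functions bounded by \<open>1\<close>: twice the supremum over events.\<close>
  "tv_dist E \<mu> \<nu> = (SUP f \<in> {f \<in> borel_measurable E. \<forall>x\<in>space E. \<bar>f x\<bar> \<le> 1}.
      \<bar>(\<integral>x. f x \<partial>\<mu>) - (\<integral>x. f x \<partial>\<nu>)\<bar>)"

definition prob_on :: "'e measure \<Rightarrow> 'e set \<Rightarrow> 'e measure set" where
  \<comment> \<open>Probability measures on a measurable \<open>S\<close>, as measures on \<open>E\<close> giving full mass to \<open>S\<close>.\<close>
  "prob_on E S = {\<mu> \<in> space (prob_algebra E). emeasure \<mu> S = 1}"


text \<open>
  Both time sets are subsets of the reals. The locale does not constrain \<open>P s x\<close> on the
  coordinates before time \<open>s\<close>.
\<close>

locale process_basics =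
  fixes I :: "real set"
    and E :: "'e::metric_space measure"
    and \<Omega> :: "'w set"
    and X :: "real \<Rightarrow> 'w \<Rightarrow> 'e"
    and P :: "real \<Rightarrow> 'e \<Rightarrow> 'w measure"
begin

definition to_infinity :: "real filter" where
  "to_infinity = inf at_top (principal I)"

text \<open>
  The filtration is indexed by \<open>ereal\<close> so that stopping times may be infinite and the library
  notions \<^const>\<open>stopping_time\<close> and \<^const>\<open>filtration.pre_sigma\<close> apply. For stopping times with
  values in \<open>I \<union> {\<infinity>}\<close>, testing \<open>T \<le> t\<close> at all extended real \<open>t\<close> is equivalent to testing it at
  \<open>t \<in> I\<close>. \<open>\<F> \<infinity>\<close> is the \<open>\<sigma>\<close>-algebra generated by the whole process.
\<close>

definition \<F> :: "ereal \<Rightarrow> 'w measure" where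
  "\<F> t = sigma \<Omega> {X u -` B \<inter> \<Omega> | u B. u \<in> I \<and> ereal u \<le> t \<and> B \<in> sets E}"

abbreviation path_algebra :: "(real \<Rightarrow> 'e) measure" where
  "path_algebra \<equiv> PiM I (\<lambda>_. E)"

definition path_from :: "real \<Rightarrow> 'w \<Rightarrow> real \<Rightarrow> 'e" where
  "path_from r \<omega> = (\<lambda>u\<in>I. X (r + u) \<omega>)"

definition law_from :: "real \<Rightarrow> 'e measure \<Rightarrow> 'w measure" where
  "law_from s \<mu> = \<mu> \<bind> P s"

definition hit_from :: "real \<Rightarrow> (real \<Rightarrow> 'e set) \<Rightarrow> 'w \<Rightarrow> ereal" where
  "hit_from s B \<omega> = (INF t \<in> {t \<in> I. s \<le> t \<and> X t \<omega> \<in> B t}. ereal t)"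

definition survival :: "'w measure \<Rightarrow> ('w \<Rightarrow> ereal) \<Rightarrow> real \<Rightarrow> real" where
  "survival Q T t = measure Q {\<omega> \<in> \<Omega>. ereal t < T \<omega>}"

text \<open>The law of \<open>X t\<close> under \<open>Q\<close> conditioned on \<open>T > t\<close>.\<close>

definition cond_law :: "'w measure \<Rightarrow> ('w \<Rightarrow> ereal) \<Rightarrow> real \<Rightarrow> 'e measure" where
  "cond_law Q T t = distr (uniform_measure Q {\<omega> \<in> \<Omega>. ereal t < T \<omega>}) E (X t)"

definition strong_markov :: bool where
  \<comment> \<open>The first conjunct says that the conditioned event is measurable. On \<open>T \<omega> = \<infinity>\<close> the right-hand
      side of the second vanishes because of the indicator.\<close>
  "strong_markov \<longleftrightarrow>
    (\<forall>T. stopping_time \<F> T \<and> (\<forall>\<omega>\<in>\<Omega>. T \<omega> \<in> ereal ` I \<union> {\<infinity>}) \<longrightarrow>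
      (\<lambda>\<omega>. path_from (real_of_ereal (T \<omega>)) \<omega>)
         \<in> restrict_space (\<F> \<infinity>) {\<omega> \<in> \<Omega>. T \<omega> < \<infinity>} \<rightarrow>\<^sub>M path_algebra \<and>
      (\<forall>x\<in>space E. \<forall>B\<in>sets path_algebra.
        AE \<omega> in P 0 x.
          real_cond_exp (P 0 x) (filtration.pre_sigma \<Omega> \<F> T)
            (indicator {\<omega> \<in> \<Omega>. T \<omega> < \<infinity> \<and> path_from (real_of_ereal (T \<omega>)) \<omega> \<in> B}) \<omega>
          = indicator {\<omega> \<in> \<Omega>. T \<omega> < \<infinity>} \<omega> *
            measure (P 0 (X (real_of_ereal (T \<omega>)) \<omega>)) {\<omega>' \<in> \<Omega>. path_from 0 \<omega>' \<in> B}))"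

end

text \<open>
  The condition \<open>shift\<close> is the usual requirement that a Markov process comes with shift operators on
  its sample space; it holds for instance for the coordinate process on all, on continuous or on
  cadlag paths. It is what turns hitting events, which need not be visible in the product
  \<open>\<sigma>\<close>-algebra on paths, into events to which the Markov property applies.
\<close>

locale homogeneous_markov_process = process_basics I E \<Omega> X P
  for I :: "real set" and E :: "'e::metric_space measure" and \<Omega> :: "'w set"
    and X :: "real \<Rightarrow> 'w \<Rightarrow> 'e" and P :: "real \<Rightarrow> 'e \<Rightarrow> 'w measure" +
  assumes time_set: "I = \<nat> \<or> I = {0..}"
    and space_E: "space E = UNIV"
    and shift: "\<And>r \<omega>. r \<in> I \<Longrightarrow> \<omega> \<in> \<Omega> \<Longrightarrow> \<exists>\<omega>'\<in>\<Omega>. \<forall>u\<in>I. X u \<omega>' = X (r + u) \<omega>"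
    and kernel: "\<And>s. s \<in> I \<Longrightarrow> P s \<in> E \<rightarrow>\<^sub>M prob_algebra (\<F> \<infinity>)"
    and start: "\<And>s x. s \<in> I \<Longrightarrow> AE \<omega> in P s x. X s \<omega> = x"
    and homogeneous: "\<And>s x. s \<in> I \<Longrightarrow>
      distr (P s x) path_algebra (path_from s) = distr (P 0 x) path_algebra (path_from 0)"
    and markov: "\<And>r x B. r \<in> I \<Longrightarrow> B \<in> sets path_algebra \<Longrightarrow>
      AE \<omega> in P 0 x.
        real_cond_exp (P 0 x) (\<F> (ereal r)) (indicator {\<omega> \<in> \<Omega>. path_from r \<omega> \<in> B}) \<omega>
        = measure (P 0 (X r \<omega>)) {\<omega>' \<in> \<Omega>. path_from 0 \<omega>' \<in> B}"

locale boundary_basics = process_basics I E \<Omega> X P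
  for I :: "real set" and E :: "'e::metric_space measure" and \<Omega> :: "'w set"
    and X :: "real \<Rightarrow> 'w \<Rightarrow> 'e" and P :: "real \<Rightarrow> 'e \<Rightarrow> 'w measure" +
  fixes A :: "real \<Rightarrow> 'e set"
begin

definition alive :: "real \<Rightarrow> 'e set" where
  "alive t = space E - A t"

definition A_inf :: "'e set" where
  "A_inf = (\<Inter>t\<in>I. A t)"

definition alive_inf :: "'e set" where
  "alive_inf = space E - A_inf"

text \<open>\<open>tau s\<close> is \<open>\<tau>\<^sub>A\<close> as it is read under the measures started at time \<open>s\<close>.\<close>

definition tau :: "real \<Rightarrow> 'w \<Rightarrow> ereal" where
  "tau s = hit_from s A"

definition tau_inf :: "'w \<Rightarrow> ereal" where
  "tau_inf = hit_from 0 (\<lambda>_. A_inf)"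

definition assumption_A' :: bool where
  "assumption_A' \<longleftrightarrow>
    (\<exists>\<nu> t0 c1 c2. (\<forall>s\<in>I. \<nu> s \<in> prob_on E (alive s)) \<and> t0 \<in> I \<and> 0 < t0 \<and> 0 < c1 \<and> 0 < c2 \<and>
      (\<forall>s\<in>I. \<forall>x\<in>alive s. \<forall>B\<in>sets E.
         c1 * measure (\<nu> (s + t0)) B \<le> measure (cond_law (P s x) (tau s) (s + t0)) B) \<and>
      (\<forall>s\<in>I. \<forall>t\<in>I. s \<le> t \<longrightarrow> (\<forall>x\<in>alive s.
         c2 * survival (P s x) (tau s) t \<le> survival (law_from s (\<nu> s)) (tau s) t)))"

definition H_hom :: bool where
  "H_hom \<longleftrightarrow>
    strong_markov \<and>
    (\<forall>x\<in>alive 0. \<forall>t\<in>I.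
       ((\<lambda>s. survival (P s x) (tau s) (s + t)) \<longlongrightarrow> survival (P 0 x) tau_inf t) to_infinity) \<and>
    (\<forall>x\<in>alive 0. \<forall>s\<in>I.
       continuous_on {t \<in> I. s \<le> t} (survival (P s x) (tau s)) \<and>
       continuous_on I (survival (P 0 x) tau_inf))"

definition exp_attracting :: "'e measure \<Rightarrow> bool" where
  "exp_attracting \<alpha> \<longleftrightarrow>
    \<alpha> \<in> prob_on E alive_inf \<and>
    (\<exists>C>0. \<exists>\<gamma>>0. \<forall>\<mu>\<in>prob_on E alive_inf. \<forall>t\<in>I.
       tv_dist E (cond_law (law_from 0 \<mu>) tau_inf t) \<alpha> \<le> C * exp (- \<gamma> * t))"

definition H_inf :: "'e measure \<Rightarrow> bool" where
  "H_inf \<alpha> \<longleftrightarrow> exp_attracting \<alpha> \<and> (\<forall>\<beta>. exp_attracting \<beta> \<longrightarrow> \<beta> = \<alpha>)"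

text \<open>
  Under the assumptions above the exponential rate and the limit defining \<open>eta_inf\<close> are known to exist,
  and both are then unique.
\<close>

definition lambda_inf :: "'e measure \<Rightarrow> real" where
  "lambda_inf \<alpha> = (THE l. 0 < l \<and> (\<forall>t\<in>I. survival (law_from 0 \<alpha>) tau_inf t = exp (- l * t)))"

definition eta_inf :: "'e measure \<Rightarrow> 'e \<Rightarrow> real" where
  "eta_inf \<alpha> x =
    (if x \<in> alive_inf
     then Lim to_infinity (\<lambda>t. exp (lambda_inf \<alpha> * t) * survival (P 0 x) tau_inf t)
     else 0)"

definition H_inf' :: "'e measure \<Rightarrow> bool" where
  \<comment> \<open>Expectations of nonnegative quantities; \<open>tau s\<close> is almost surely finite, so the value \<open>0\<close> of
      \<^const>\<open>real_of_ereal\<close> at \<open>\<infinity>\<close> plays no role.\<close>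
  "H_inf' \<alpha> \<longleftrightarrow>
    (\<exists>s0\<in>I. \<exists>x0\<in>alive s0.
      (\<forall>s\<in>I. s0 \<le> s \<longrightarrow>
        (\<integral>\<^sup>+\<omega>. ennreal (exp (lambda_inf \<alpha> * real_of_ereal (tau s \<omega>)) *
                eta_inf \<alpha> (X (real_of_ereal (tau s \<omega>)) \<omega>)) \<partial>P s x0) < \<infinity>) \<and>
      ((\<lambda>s. \<integral>\<^sup>+\<omega>. ennreal (exp (lambda_inf \<alpha> * (real_of_ereal (tau s \<omega>) - s)) *
                eta_inf \<alpha> (X (real_of_ereal (tau s \<omega>)) \<omega>)) \<partial>P s x0) \<longlongrightarrow> 0) to_infinity)"

end

text \<open>
  Under \<open>P s x\<close> time starts at \<open>s\<close>; counted from there, \<open>\<tau>\<^sub>A\<close> is the hitting time of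
  \<open>u \<mapsto> A (s + u)\<close>, and this is required to be a stopping time. For \<open>s = 0\<close> this is the statement
  that \<open>\<tau>\<^sub>A\<close> is a stopping time, and by \<open>shift\<close> it implies for every \<open>s\<close> that \<open>tau s\<close> is one.
\<close>

locale moving_boundary_process =
  homogeneous_markov_process I E \<Omega> X P + boundary_basics I E \<Omega> X P A
  for I :: "real set" and E :: "'e::metric_space measure" and \<Omega> :: "'w set"
    and X :: "real \<Rightarrow> 'w \<Rightarrow> 'e" and P :: "real \<Rightarrow> 'e \<Rightarrow> 'w measure"
    and A :: "real \<Rightarrow> 'e set" +
  assumes A_sets: "\<And>t. t \<in> I \<Longrightarrow> A t \<in> sets E"
    and tau_stopping: "\<And>s. s \<in> I \<Longrightarrow> stopping_time \<F> (hit_from 0 (\<lambda>u. A (s + u)))"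
    and tau_inf_stopping: "stopping_time \<F> tau_inf"
    and tau_finite: "\<And>s x. s \<in> I \<Longrightarrow> x \<in> alive s \<Longrightarrow>
      measure (P s x) {\<omega> \<in> \<Omega>. tau s \<omega> < \<infinity>} = 1"
    and survival_pos: "\<And>s t x. s \<in> I \<Longrightarrow> t \<in> I \<Longrightarrow> s \<le> t \<Longrightarrow> x \<in> alive s \<Longrightarrow>
      0 < survival (P s x) (tau s) t"

end

theory Submission
  imports Defs
begin

text \<open>
  Assumption (A') yields a Doeblin minorization for the process conditioned on survival, uniform in
  the starting time and point: over \<open>n\<close> periods of length \<open>t\<^sub>0\<close> the conditional expectation of a
  test function has oscillation at most \<open>2 (1 - c\<^sub>1 c\<^sub>2) ^ n\<close>. Hence at time \<open>s + n t\<^sub>0\<close> the law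
  started from \<open>\<mu>\<close> at time \<open>0\<close> may be replaced by the one started at time \<open>s\<close> from a fixed
  \<open>x \<in> E\<^sub>0 \<subseteq> E\<^sub>s\<close>. As \<open>s\<close> tends to infinity with \<open>n\<close> fixed, that law converges in total variation
  to the law conditioned on not hitting \<open>A\<^sub>\<infinity>\<close>: since \<open>\<tau>\<^sub>A \<le> \<tau>\<^sub>A\<^sub>\<infinity>\<close>, the difference of the two
  killed laws is bounded by the difference of their masses, which vanishes by part (b) of
  \<open>H_hom\<close>. By \<open>H_inf\<close> the limit is \<open>C exp (- \<gamma> n t\<^sub>0)\<close>-close to \<open>\<alpha>\<close>, and
  \<open>n\<close> is arbitrary.
\<close>

section \<open>Doeblin contraction\<close>

text \<open>The setwise bound says \<open>scale_measure c \<nu> \<le> \<kappa>\<close>, and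
  nonnegative integrals are monotone in the measure; boundedness of \<open>k\<close> carries this
  back to real integrals. Nonnegativity is asked only almost everywhere, since later it is known
  only at surviving points.\<close>

lemma minorized_integral:
  fixes k :: "'a \<Rightarrow> real"
  assumes \<kappa>: "finite_measure \<kappa>" and \<nu>: "finite_measure \<nu>" and sets: "sets \<kappa> = sets \<nu>" and c: "0 \<le> c"
    and minor: "\<And>B. B \<in> sets \<nu> \<Longrightarrow> c * measure \<nu> B \<le> measure \<kappa> B"
    and k [measurable]: "k \<in> borel_measurable \<nu>" and bound: "\<And>x. \<bar>k x\<bar> \<le> b"
    and nonneg: "AE x in \<kappa>. 0 \<le> k x" "AE x in \<nu>. 0 \<le> k x"
  shows "c * (\<integral>x. k x \<partial>\<nu>) \<le> (\<integral>x. k x \<partial>\<kappa>)"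
proof -
  interpret \<kappa>: finite_measure \<kappa> by fact
  interpret \<nu>: finite_measure \<nu> by fact
  have [measurable]: "k \<in> borel_measurable \<kappa>" using k measurable_cong_sets[OF sets refl] by blast
  have int: "integrable \<kappa> k" "integrable \<nu> k"
    using bound by (auto intro!: \<kappa>.integrable_const_bound[of _ b] \<nu>.integrable_const_bound[of _ b])
  have "scale_measure (ennreal c) \<nu> \<le> \<kappa>"
    using minor sets c
    by (subst le_measure)
       (auto simp: \<kappa>.emeasure_eq_measure \<nu>.emeasure_eq_measure ennreal_mult[symmetric])
  then have "(\<integral>\<^sup>+x. ennreal (k x) \<partial>scale_measure (ennreal c) \<nu>) \<le> (\<integral>\<^sup>+x. ennreal (k x) \<partial>\<kappa>)"
    using sets by (intro nn_integral_mono_measure) auto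
  then have "ennreal (c * (\<integral>x. k x \<partial>\<nu>)) \<le> ennreal (\<integral>x. k x \<partial>\<kappa>)"
    using int nonneg c
    by (simp add: nn_integral_scale_measure nn_integral_eq_integral ennreal_mult integral_nonneg_AE)
  then show ?thesis
    using nonneg by (simp add: ennreal_le_iff integral_nonneg_AE)
qed

text \<open>Think of \<open>\<kappa>\<close> as a killed law, of \<open>h\<close> as the probability
  of surviving afterwards and of \<open>g\<close> as the killed expectation of a test function. Both
  \<open>g - a * h\<close> and \<open>b * h - g\<close> are nonnegative, so the minorization bounds
  their \<open>\<kappa>\<close>-integrals below through their \<open>\<nu>\<close>-integrals, which
  are \<open>p - a\<close> and \<open>b - p\<close> times the \<open>\<nu>\<close>-integral of
  \<open>h\<close>. Each end of \<open>[a, b]\<close> thus moves towards \<open>p\<close>, and the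
  length shrinks by the factor \<open>1 - c1 * c2\<close>.\<close>

lemma doeblin_contraction:
  fixes g h :: "'a \<Rightarrow> real"
  assumes \<kappa>: "finite_measure \<kappa>" and \<nu>: "prob_space \<nu>" and sets: "sets \<kappa> = sets \<nu>"
    and c: "0 \<le> c1" "0 \<le> c2"
    and minor: "\<And>B. B \<in> sets \<nu> \<Longrightarrow> c1 * measure \<kappa> (space \<kappa>) * measure \<nu> B \<le> measure \<kappa> B"
    and [measurable]: "g \<in> borel_measurable \<nu>" "h \<in> borel_measurable \<nu>"
    and bound: "\<And>x. \<bar>g x\<bar> \<le> 1" "\<And>x. \<bar>h x\<bar> \<le> 1"
    and between: "AE x in \<kappa>. a * h x \<le> g x \<and> g x \<le> b * h x" "AE x in \<nu>. a * h x \<le> g x \<and> g x \<le> b * h x"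
    and dominated: "AE x in \<kappa>. c2 * h x \<le> (\<integral>y. h y \<partial>\<nu>)" and pos: "0 < (\<integral>y. h y \<partial>\<nu>)"
  defines "p \<equiv> (\<integral>y. g y \<partial>\<nu>) / (\<integral>y. h y \<partial>\<nu>)"
  shows "(a + c1 * c2 * (p - a)) * (\<integral>x. h x \<partial>\<kappa>) \<le> (\<integral>x. g x \<partial>\<kappa>)"
    and "(\<integral>x. g x \<partial>\<kappa>) \<le> (b - c1 * c2 * (b - p)) * (\<integral>x. h x \<partial>\<kappa>)"
proof -
  interpret \<kappa>: finite_measure \<kappa> by fact
  interpret \<nu>: prob_space \<nu> by fact
  have [measurable]: "g \<in> borel_measurable \<kappa>" "h \<in> borel_measurable \<kappa>"
    using assms(7,8) measurable_cong_sets[OF sets refl] by blast+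
  have int [simp]: "integrable \<kappa> g" "integrable \<kappa> h" "integrable \<nu> g" "integrable \<nu> h"
    using bound by (auto intro!: \<kappa>.integrable_const_bound[of _ 1] \<nu>.integrable_const_bound[of _ 1])
  \<comment> \<open>The dominating bound is a constant, so its integral contributes the total mass
    of \<open>\<kappa>\<close>, the very factor that \<open>minor\<close> carries.\<close>
  have "(\<integral>x. c2 * h x \<partial>\<kappa>) \<le> (\<integral>x. (\<integral>y. h y \<partial>\<nu>) \<partial>\<kappa>)"
    using dominated by (intro integral_mono_AE) auto
  then have dom: "c2 * (\<integral>x. h x \<partial>\<kappa>) \<le> measure \<kappa> (space \<kappa>) * (\<integral>y. h y \<partial>\<nu>)"
    by simp
  \<comment> \<open>Used for \<open>k = g - a * h\<close> with \<open>q = p - a\<close> and for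
    \<open>k = b * h - g\<close> with \<open>q = b - p\<close>.\<close>
  have key: "c1 * c2 * q * (\<integral>x. h x \<partial>\<kappa>) \<le> (\<integral>x. k x \<partial>\<kappa>)"
    if k [measurable]: "k \<in> borel_measurable \<nu>" and kb: "\<And>x. \<bar>k x\<bar> \<le> e"
      and kn: "AE x in \<kappa>. 0 \<le> k x" "AE x in \<nu>. 0 \<le> k x"
      and q: "(\<integral>x. k x \<partial>\<nu>) = q * (\<integral>y. h y \<partial>\<nu>)" for k e q
  proof -
    have "0 \<le> (\<integral>x. k x \<partial>\<nu>)" using kn by (intro integral_nonneg_AE)
    then have q0: "0 \<le> q" using q pos by (simp add: zero_le_mult_iff)
    have "c1 * q * (c2 * (\<integral>x. h x \<partial>\<kappa>)) \<le> c1 * q * (measure \<kappa> (space \<kappa>) * (\<integral>y. h y \<partial>\<nu>))"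
      using q0 c dom by (intro mult_left_mono) auto
    also have "\<dots> = c1 * measure \<kappa> (space \<kappa>) * (\<integral>x. k x \<partial>\<nu>)" by (simp add: q)
    also have "\<dots> \<le> (\<integral>x. k x \<partial>\<kappa>)"
      using c minor kb kn by (intro minorized_integral[OF \<kappa> \<nu>.finite_measure_axioms sets]) auto
    finally show ?thesis by (simp add: mult_ac)
  qed
  have "\<bar>g x - a * h x\<bar> \<le> 1 + \<bar>a\<bar>" "\<bar>b * h x - g x\<bar> \<le> 1 + \<bar>b\<bar>" for x
    using bound[of x] mult_left_mono[OF bound(2)[of x], of "\<bar>a\<bar>"] mult_left_mono[OF bound(2)[of x], of "\<bar>b\<bar>"]
    by (auto simp flip: abs_mult)
  note kb = this
  have "c1 * c2 * (p - a) * (\<integral>x. h x \<partial>\<kappa>) \<le> (\<integral>x. g x - a * h x \<partial>\<kappa>)"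
    using between pos by (intro key[OF _ kb(1)]) (auto simp: p_def field_simps)
  then show "(a + c1 * c2 * (p - a)) * (\<integral>x. h x \<partial>\<kappa>) \<le> (\<integral>x. g x \<partial>\<kappa>)"
    by (simp add: algebra_simps)
  have "c1 * c2 * (b - p) * (\<integral>x. h x \<partial>\<kappa>) \<le> (\<integral>x. b * h x - g x \<partial>\<kappa>)"
    using between pos by (intro key[OF _ kb(2)]) (auto simp: p_def field_simps)
  then show "(\<integral>x. g x \<partial>\<kappa>) \<le> (b - c1 * c2 * (b - p)) * (\<integral>x. h x \<partial>\<kappa>)"
    by (simp add: algebra_simps)
qed

section \<open>Killed Markov processes\<close>

context process_basics
begin

lemma eventually_to_infinity: "eventually Q to_infinity \<longleftrightarrow> (\<exists>r. \<forall>t\<in>I. r \<le> t \<longrightarrow> Q t)"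
  unfolding to_infinity_def eventually_inf_principal eventually_at_top_linorder by blast

text \<open>A gap \<open>e\<close> is required because the infimum need not be attained: in
  continuous time hits may accumulate at \<open>t\<close> from the right. A path that never hits
  satisfies the criterion vacuously, in accordance with the infimum \<open>\<infinity>\<close> of
  the empty set.\<close>

lemma less_hit_from_iff:
  "ereal t < hit_from s D \<omega> \<longleftrightarrow> (\<exists>e>0. \<forall>u\<in>I. s \<le> u \<longrightarrow> X u \<omega> \<in> D u \<longrightarrow> t + e \<le> u)"
proof
  assume "ereal t < hit_from s D \<omega>"
  then obtain z where z: "ereal t < ereal z" "ereal z < hit_from s D \<omega>"
    using ereal_dense2 by blast
  have "z \<le> u" if "u \<in> I" "s \<le> u" "X u \<omega> \<in> D u" for u
  proof -
    have "hit_from s D \<omega> \<le> ereal u"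
      unfolding hit_from_def using that by (intro INF_lower) auto
    then show ?thesis
      using z by (metis ereal_less_eq(3) less_le_trans order_less_imp_le)
  qed
  then show "\<exists>e>0. \<forall>u\<in>I. s \<le> u \<longrightarrow> X u \<omega> \<in> D u \<longrightarrow> t + e \<le> u"
    using z by (intro exI[of _ "z - t"]) auto
next
  assume "\<exists>e>0. \<forall>u\<in>I. s \<le> u \<longrightarrow> X u \<omega> \<in> D u \<longrightarrow> t + e \<le> u"
  then obtain e where e: "e > 0" "\<And>u. u \<in> I \<Longrightarrow> s \<le> u \<Longrightarrow> X u \<omega> \<in> D u \<Longrightarrow> t + e \<le> u"
    by blast
  have "ereal (t + e) \<le> hit_from s D \<omega>"
    unfolding hit_from_def by (rule INF_greatest) (use e in auto)
  moreover have "ereal t < ereal (t + e)" using e by simp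
  ultimately show "ereal t < hit_from s D \<omega>" by (rule less_le_trans[rotated])
qed

text \<open>The unnormalised counterpart of \<open>cond_law\<close>. Being linear in
  \<open>Q\<close>, it commutes with mixtures of initial laws and composes over successive time
  intervals, which conditional laws do not.\<close>

definition killed_law :: "'w measure \<Rightarrow> ('w \<Rightarrow> ereal) \<Rightarrow> real \<Rightarrow> 'e measure" where
  "killed_law Q T t = distr (density Q (indicator {\<omega> \<in> \<Omega>. ereal t < T \<omega>})) E (X t)"

lemma sets_killed_law [measurable_cong, simp]: "sets (killed_law Q T t) = sets E"
  by (simp add: killed_law_def)

lemma space_killed_law [simp]: "space (killed_law Q T t) = space E"
  by (simp add: killed_law_def)

lemma space_F [simp]: "space (\<F> t) = \<Omega>"
  unfolding \<F>_def by (auto intro!: space_measure_of)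

lemma sets_F: "sets (\<F> t) = sigma_sets \<Omega> {X u -` B \<inter> \<Omega> | u B. u \<in> I \<and> ereal u \<le> t \<and> B \<in> sets E}"
  unfolding \<F>_def by (rule sets_measure_of) auto

lemma sets_F_mono: "s \<le> t \<Longrightarrow> sets (\<F> s) \<subseteq> sets (\<F> t)"
  unfolding sets_F by (rule sigma_sets_mono') (auto intro: order_trans)

end

context homogeneous_markov_process
begin

section \<open>Arithmetic of the time set and measurability of paths\<close>

lemma time_0 [simp]: "0 \<in> I"
  using time_set by auto

lemma time_nonneg: "t \<in> I \<Longrightarrow> 0 \<le> t"
  using time_set by (auto simp: Nats_def)

lemma time_add: "s \<in> I \<Longrightarrow> t \<in> I \<Longrightarrow> s + t \<in> I"
  using time_set by auto

lemma time_diff: "s \<in> I \<Longrightarrow> t \<in> I \<Longrightarrow> s \<le> t \<Longrightarrow> t - s \<in> I"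
  using time_set by auto

lemma time_of_nat_mult: "t \<in> I \<Longrightarrow> real n * t \<in> I"
  using time_set by auto

lemma X_measurable: "u \<in> I \<Longrightarrow> ereal u \<le> t \<Longrightarrow> X u \<in> \<F> t \<rightarrow>\<^sub>M E"
  by (rule measurableI) (auto simp: space_E sets_F intro!: sigma_sets.Basic)

lemma X_measurable' [measurable]: "u \<in> I \<Longrightarrow> X u \<in> \<F> \<infinity> \<rightarrow>\<^sub>M E"
  by (rule X_measurable) auto

lemma path_from_measurable [measurable]: "r \<in> I \<Longrightarrow> path_from r \<in> \<F> \<infinity> \<rightarrow>\<^sub>M path_algebra"
  unfolding path_from_def
  by (rule measurable_restrict) (use time_add in auto)

text \<open>\<open>\<F> \<infinity>\<close> is generated by the coordinates, hence contained in the
  pullback of the product algebra under \<open>path_from 0\<close>. Events known only to be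
  measurable, such as hitting events, thereby become path events, the form in which
  \<open>homogeneous\<close> and \<open>markov\<close> speak.\<close>

lemma sets_F_path:
  assumes "N \<in> sets (\<F> \<infinity>)"
  obtains B where "B \<in> sets path_algebra" "N = {\<omega> \<in> \<Omega>. path_from 0 \<omega> \<in> B}"
proof -
  have map: "path_from 0 \<in> \<Omega> \<rightarrow> space path_algebra"
    using measurable_space[OF path_from_measurable[OF time_0]] by auto
  have "sets (\<F> \<infinity>) \<subseteq> sets (vimage_algebra \<Omega> (path_from 0) path_algebra)"
    unfolding sets_F
  proof (rule sets.sigma_sets_subset[of _ "vimage_algebra \<Omega> (path_from 0) path_algebra", simplified], safe)
    fix u B assume u: "u \<in> I" and B: "B \<in> sets E"
    have "X u -` B \<inter> \<Omega> = path_from 0 -` ((\<lambda>p. p u) -` B \<inter> space path_algebra) \<inter> \<Omega>"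
      using u map by (auto simp: path_from_def)
    moreover have "(\<lambda>p. p u) -` B \<inter> space path_algebra \<in> sets path_algebra"
      using u B by measurable
    ultimately show "X u -` B \<inter> \<Omega> \<in> sets (vimage_algebra \<Omega> (path_from 0) path_algebra)"
      unfolding sets_vimage_algebra2[OF map] by blast
  qed
  then show ?thesis
    using assms that by (fastforce simp: sets_vimage_algebra2[OF map])
qed

lemma sets_P [simp, measurable_cong]: "s \<in> I \<Longrightarrow> sets (P s x) = sets (\<F> \<infinity>)"
  using measurable_space[OF kernel, of s x] by (auto simp: space_E space_prob_algebra)

lemma space_P [simp]: "s \<in> I \<Longrightarrow> space (P s x) = \<Omega>"
  using sets_eq_imp_space_eq[OF sets_P] by simp

lemma prob_space_P: "s \<in> I \<Longrightarrow> prob_space (P s x)"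
  using measurable_space[OF kernel, of s x] by (auto simp: space_E space_prob_algebra)

lemma kernel_0_measurable [measurable]: "P 0 \<in> E \<rightarrow>\<^sub>M subprob_algebra (\<F> \<infinity>)"
  using kernel[OF time_0] by (rule measurable_prob_algebraD)

lemma path_event [measurable]: "r \<in> I \<Longrightarrow> B \<in> sets path_algebra \<Longrightarrow> {\<omega> \<in> \<Omega>. path_from r \<omega> \<in> B} \<in> sets (\<F> \<infinity>)"
  using measurable_sets[OF path_from_measurable, of r B] by (simp add: vimage_def Int_def conj_commute)

section \<open>Homogeneity and the Markov property as identities between probabilities\<close>

lemma homogeneous_event:
  assumes "s \<in> I" and B: "B \<in> sets path_algebra"
  shows "emeasure (P s x) {\<omega> \<in> \<Omega>. path_from s \<omega> \<in> B} = emeasure (P 0 x) {\<omega> \<in> \<Omega>. path_from 0 \<omega> \<in> B}"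
proof -
  have "emeasure (distr (P r x) path_algebra (path_from r)) B = emeasure (P r x) {\<omega> \<in> \<Omega>. path_from r \<omega> \<in> B}"
    if "r \<in> {0, s}" for r
  proof -
    have "r \<in> I" using that assms by auto
    then show ?thesis
      by (subst emeasure_distr) (use B in \<open>auto simp: vimage_def Int_def conj_commute\<close>)
  qed
  from this[of 0] this[of s] homogeneous[of s x] assms show ?thesis by simp
qed

text \<open>Integrating the almost sure identity \<open>markov\<close> over \<open>N\<close>
  replaces the conditional expectation by the event itself, by its defining property on
  \<open>\<F> (ereal r)\<close>. The result is put in extended nonnegative form because it feeds
  equalities of measures.\<close>

lemma markov_event:
  assumes r: "r \<in> I" and N: "N \<in> sets (\<F> (ereal r))" and B: "B \<in> sets path_algebra"
  shows "emeasure (P 0 x) (N \<inter> {\<omega> \<in> \<Omega>. path_from r \<omega> \<in> B})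
    = (\<integral>\<^sup>+\<omega>. indicator N \<omega> * emeasure (P 0 (X r \<omega>)) {\<omega>' \<in> \<Omega>. path_from 0 \<omega>' \<in> B} \<partial>P 0 x)"
proof -
  interpret prob_space "P 0 x" by (rule prob_space_P) simp
  have sub: "subalgebra (P 0 x) (\<F> (ereal r))"
    using sets_F_mono[of "ereal r" \<infinity>] by (simp add: subalgebra_def)
  interpret finite_measure_subalgebra "P 0 x" "\<F> (ereal r)"
    by unfold_locales (rule sub)
  define G where "G = {\<omega> \<in> \<Omega>. path_from r \<omega> \<in> B}"
  define H where "H = {\<omega> \<in> \<Omega>. path_from 0 \<omega> \<in> B}"
  have G [measurable]: "G \<in> sets (\<F> \<infinity>)" and H [measurable]: "H \<in> sets (\<F> \<infinity>)"
    unfolding G_def H_def using r B by (auto intro: path_event)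
  have "G \<inter> \<Omega> = G" unfolding G_def by auto
  have N' [measurable]: "N \<in> sets (\<F> \<infinity>)"
    using N sets_F_mono[of "ereal r" \<infinity>] by auto
  have [measurable]: "(\<lambda>\<omega>. measure (P 0 (X r \<omega>)) H) \<in> borel_measurable (\<F> \<infinity>)"
    using r by measurable
  have [measurable]: "real_cond_exp (P 0 x) (\<F> (ereal r)) (indicator G) \<in> borel_measurable (\<F> \<infinity>)"
    using borel_measurable_cond_exp2[of "P 0 x" "\<F> (ereal r)" "indicator G"] by (simp cong: measurable_cong_sets)
  have "(\<lambda>\<omega>. indicator N \<omega> *\<^sub>R real_cond_exp (P 0 x) (\<F> (ereal r)) (indicator G) \<omega>) \<in> borel_measurable (\<F> \<infinity>)"
    "(\<lambda>\<omega>. indicator N \<omega> *\<^sub>R measure (P 0 (X r \<omega>)) H) \<in> borel_measurable (\<F> \<infinity>)"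
    by measurable
  then have meas: "(\<lambda>\<omega>. indicator N \<omega> *\<^sub>R real_cond_exp (P 0 x) (\<F> (ereal r)) (indicator G) \<omega>) \<in> borel_measurable (P 0 x)"
    "(\<lambda>\<omega>. indicator N \<omega> *\<^sub>R measure (P 0 (X r \<omega>)) H) \<in> borel_measurable (P 0 x)"
    by (simp_all only: measurable_cong_sets[OF sets_P[OF time_0, of x] refl])
  have bnd: "measure (P 0 y) H \<le> 1" for y
    using prob_space_P[of 0 y] by (simp add: prob_space.prob_le_1)
  have "measure (P 0 x) (N \<inter> G) = (LINT \<omega>:N|P 0 x. indicator G \<omega>)"
    using \<open>G \<inter> \<Omega> = G\<close>
    by (simp add: set_lebesgue_integral_def indicator_inter_arith[symmetric] Int_assoc)
  also have "\<dots> = (LINT \<omega>:N|P 0 x. real_cond_exp (P 0 x) (\<F> (ereal r)) (indicator G) \<omega>)"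
    using N \<open>G \<inter> \<Omega> = G\<close> by (intro real_cond_exp_intA) (auto simp: integrable_indicator_iff emeasure_eq_measure)
  also have "\<dots> = (LINT \<omega>:N|P 0 x. measure (P 0 (X r \<omega>)) H)"
    unfolding set_lebesgue_integral_def
    using markov[OF r B, of x, folded G_def H_def] by (intro integral_cong_AE meas) auto
  finally have "emeasure (P 0 x) (N \<inter> G) = ennreal (LINT \<omega>|P 0 x. indicator N \<omega> * measure (P 0 (X r \<omega>)) H)"
    by (simp add: emeasure_eq_measure set_lebesgue_integral_def)
  also have "\<dots> = (\<integral>\<^sup>+\<omega>. ennreal (indicator N \<omega> * measure (P 0 (X r \<omega>)) H) \<partial>P 0 x)"
    using meas(2)
    by (intro nn_integral_eq_integral[symmetric] integrable_const_bound[of _ 1])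
       (auto simp: bnd split: split_indicator)
  also have "\<dots> = (\<integral>\<^sup>+\<omega>. indicator N \<omega> * emeasure (P 0 (X r \<omega>)) H \<partial>P 0 x)"
    by (intro nn_integral_cong)
       (auto simp: ennreal_mult prob_space_P finite_measure.emeasure_eq_measure prob_space.finite_measure split: split_indicator)
  finally show ?thesis unfolding G_def H_def .
qed

section \<open>Shifted paths and hitting times\<close>

lemma path_from_shift:
  assumes "r \<in> I" "\<omega> \<in> \<Omega>" "\<omega>' \<in> \<Omega>" "\<forall>u\<in>I. X u \<omega>' = X (r + u) \<omega>"
  shows "path_from 0 \<omega>' = path_from r \<omega>"
  using assms by (auto simp: path_from_def fun_eq_iff restrict_def)

text \<open>In the gap criterion, hits at \<open>u\<close> of the shifted path correspond to hits at
  \<open>r + u\<close> of the original one, with the same gap \<open>e\<close>.\<close>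

lemma less_hit_from_shift:
  assumes "r \<in> I" "\<forall>u\<in>I. X u \<omega>' = X (r + u) \<omega>"
  shows "ereal t < hit_from 0 (\<lambda>u. D (r + u)) \<omega>' \<longleftrightarrow> ereal (r + t) < hit_from r D \<omega>"
proof -
  have "(\<forall>u\<in>I. 0 \<le> u \<longrightarrow> X u \<omega>' \<in> D (r + u) \<longrightarrow> t + e \<le> u)
      \<longleftrightarrow> (\<forall>u\<in>I. r \<le> u \<longrightarrow> X u \<omega> \<in> D u \<longrightarrow> r + t + e \<le> u)" (is "?L \<longleftrightarrow> ?R") for e
  proof
    assume L: ?L
    show ?R
    proof safe
      fix u assume u: "u \<in> I" "r \<le> u" "X u \<omega> \<in> D u"
      then have "u - r \<in> I" using time_diff assms by auto
      with L u assms(2) show "r + t + e \<le> u" by (auto dest!: bspec[of _ _ "u - r"])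
    qed
  next
    assume R: ?R
    show ?L
    proof safe
      fix u assume "u \<in> I" "0 \<le> u" "X u \<omega>' \<in> D (r + u)"
      with assms have "r + u \<in> I" "r \<le> r + u" "X (r + u) \<omega> \<in> D (r + u)"
        by (auto intro: time_add)
      then have "r + t + e \<le> r + u" using R by blast
      then show "t + e \<le> u" by simp
    qed
  qed
  then show ?thesis unfolding less_hit_from_iff by simp
qed

text \<open>One path set \<open>B\<close> describes the event at both times. It comes from
  measurability at time 0; for time \<open>r\<close>, the condition \<open>shift\<close> supplies a
  sample point \<open>\<omega>'\<close> whose path from 0 is the path of \<open>\<omega>\<close>
  from \<open>r\<close>, and this transfers the description. The hitting time is thus never
  evaluated on abstract paths outside the range of the process.\<close>

lemma shifted_event:
  assumes r: "r \<in> I" and t: "t \<in> I" and C: "C \<in> sets E"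
    and N: "{\<omega> \<in> \<Omega>. ereal t < hit_from 0 (\<lambda>u. D (r + u)) \<omega>} \<in> sets (\<F> \<infinity>)"
  obtains B where "B \<in> sets path_algebra"
    "{\<omega> \<in> \<Omega>. ereal t < hit_from 0 (\<lambda>u. D (r + u)) \<omega> \<and> X t \<omega> \<in> C} = {\<omega> \<in> \<Omega>. path_from 0 \<omega> \<in> B}"
    "{\<omega> \<in> \<Omega>. ereal (r + t) < hit_from r D \<omega> \<and> X (r + t) \<omega> \<in> C} = {\<omega> \<in> \<Omega>. path_from r \<omega> \<in> B}"
proof -
  have "{\<omega> \<in> \<Omega>. ereal t < hit_from 0 (\<lambda>u. D (r + u)) \<omega> \<and> X t \<omega> \<in> C}
     = {\<omega> \<in> \<Omega>. ereal t < hit_from 0 (\<lambda>u. D (r + u)) \<omega>} \<inter> (X t -` C \<inter> space (\<F> \<infinity>))"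
    by auto
  also have "\<dots> \<in> sets (\<F> \<infinity>)"
    using N measurable_sets[OF X_measurable'[OF t] C] by (rule sets.Int)
  finally obtain B where B: "B \<in> sets path_algebra"
    "{\<omega> \<in> \<Omega>. ereal t < hit_from 0 (\<lambda>u. D (r + u)) \<omega> \<and> X t \<omega> \<in> C} = {\<omega> \<in> \<Omega>. path_from 0 \<omega> \<in> B}"
    by (rule sets_F_path)
  have "ereal (r + t) < hit_from r D \<omega> \<and> X (r + t) \<omega> \<in> C \<longleftrightarrow> path_from r \<omega> \<in> B" if \<omega>: "\<omega> \<in> \<Omega>" for \<omega>
  proof -
    obtain \<omega>' where \<omega>': "\<omega>' \<in> \<Omega>" "\<forall>u\<in>I. X u \<omega>' = X (r + u) \<omega>"
      using shift[OF r \<omega>] by blast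
    have "path_from r \<omega> \<in> B \<longleftrightarrow> path_from 0 \<omega>' \<in> B"
      using path_from_shift[OF r \<omega> \<omega>'] by simp
    also have "\<dots> \<longleftrightarrow> ereal t < hit_from 0 (\<lambda>u. D (r + u)) \<omega>' \<and> X t \<omega>' \<in> C"
      using B(2) \<omega>' by blast
    also have "\<dots> \<longleftrightarrow> ereal (r + t) < hit_from r D \<omega> \<and> X (r + t) \<omega> \<in> C"
      using less_hit_from_shift[OF r \<omega>'(2)] \<omega>'(2) t by simp
    finally show ?thesis by simp
  qed
  then show ?thesis using that B by blast
qed

section \<open>Killed laws and their normalisation\<close>

lemma emeasure_killed_law:
  assumes "sets Q = sets (\<F> \<infinity>)" "t \<in> I" "{\<omega> \<in> \<Omega>. ereal t < T \<omega>} \<in> sets (\<F> \<infinity>)" and C: "C \<in> sets E"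
  shows "emeasure (killed_law Q T t) C = emeasure Q {\<omega> \<in> \<Omega>. ereal t < T \<omega> \<and> X t \<omega> \<in> C}"
proof -
  note [measurable_cong] = assms(1)
  have [simp]: "space Q = \<Omega>" using sets_eq_imp_space_eq[OF assms(1)] by simp
  have m: "X t -` C \<inter> \<Omega> \<in> sets Q"
    using measurable_sets[OF X_measurable'[OF assms(2)] C] assms(1) by simp
  have "emeasure (killed_law Q T t) C = emeasure (density Q (indicator {\<omega> \<in> \<Omega>. ereal t < T \<omega>})) (X t -` C \<inter> \<Omega>)"
    unfolding killed_law_def
    using assms(2) C by (subst emeasure_distr) (auto)
  also have "\<dots> = (\<integral>\<^sup>+\<omega>. indicator {\<omega> \<in> \<Omega>. ereal t < T \<omega>} \<omega> * indicator (X t -` C \<inter> \<Omega>) \<omega> \<partial>Q)"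
    using assms m by (intro emeasure_density) auto
  also have "\<dots> = (\<integral>\<^sup>+\<omega>. indicator ({\<omega> \<in> \<Omega>. ereal t < T \<omega>} \<inter> (X t -` C \<inter> \<Omega>)) \<omega> \<partial>Q)"
    by (rule nn_integral_cong) (simp split: split_indicator)
  also have "\<dots> = emeasure Q ({\<omega> \<in> \<Omega>. ereal t < T \<omega>} \<inter> (X t -` C \<inter> \<Omega>))"
    using assms m by (intro nn_integral_indicator) auto
  finally show ?thesis by (simp add: Int_def vimage_def cong: conj_cong)
qed

lemma nn_integral_killed_law:
  assumes [measurable_cong]: "sets Q = sets (\<F> \<infinity>)" and [measurable]: "t \<in> I" "{\<omega> \<in> \<Omega>. ereal t < T \<omega>} \<in> sets (\<F> \<infinity>)"
    and [measurable]: "g \<in> borel_measurable E"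
  shows "(\<integral>\<^sup>+y. g y \<partial>killed_law Q T t) = (\<integral>\<^sup>+\<omega>. indicator {\<omega> \<in> \<Omega>. ereal t < T \<omega>} \<omega> * g (X t \<omega>) \<partial>Q)"
  unfolding killed_law_def by (subst nn_integral_distr; (subst nn_integral_density)?; measurable)

lemma killed_law_kernel:
  assumes [measurable]: "t \<in> I" and N: "{\<omega> \<in> \<Omega>. ereal t < T \<omega>} \<in> sets (\<F> \<infinity>)"
  shows "(\<lambda>x. killed_law (P 0 x) T t) \<in> E \<rightarrow>\<^sub>M subprob_algebra E"
proof (rule measurable_subprob_algebra)
  fix x
  interpret prob_space "P 0 x" by (rule prob_space_P) simp
  have "emeasure (killed_law (P 0 x) T t) (space E) \<le> 1"
    using assms by (subst emeasure_killed_law) (auto simp: emeasure_le_1)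
  then show "subprob_space (killed_law (P 0 x) T t)"
    by (intro subprob_spaceI) (auto simp: space_E)
next
  fix C assume [measurable]: "C \<in> sets E"
  note [measurable] = N
  have "{\<omega> \<in> \<Omega>. ereal t < T \<omega> \<and> X t \<omega> \<in> C} = {\<omega> \<in> \<Omega>. ereal t < T \<omega>} \<inter> (X t -` C \<inter> space (\<F> \<infinity>))" by auto
  also have "\<dots> \<in> sets (\<F> \<infinity>)" by measurable
  finally have [measurable]: "{\<omega> \<in> \<Omega>. ereal t < T \<omega> \<and> X t \<omega> \<in> C} \<in> sets (\<F> \<infinity>)" .
  show "(\<lambda>x. emeasure (killed_law (P 0 x) T t) C) \<in> borel_measurable E"
    using assms by (simp add: emeasure_killed_law)
qed simp


lemma killed_event_measurable:
  assumes "t \<in> I" "{\<omega> \<in> \<Omega>. ereal t < T \<omega>} \<in> sets (\<F> \<infinity>)" "C \<in> sets E"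
  shows "{\<omega> \<in> \<Omega>. ereal t < T \<omega> \<and> X t \<omega> \<in> C} \<in> sets (\<F> \<infinity>)"
proof -
  have "{\<omega> \<in> \<Omega>. ereal t < T \<omega> \<and> X t \<omega> \<in> C} = {\<omega> \<in> \<Omega>. ereal t < T \<omega>} \<inter> (X t -` C \<inter> space (\<F> \<infinity>))"
    by auto
  then show ?thesis
    using assms(2) measurable_sets[OF X_measurable'[OF assms(1)] assms(3)] by simp
qed

lemma survival_eq_killed_law:
  assumes "sets Q = sets (\<F> \<infinity>)" "t \<in> I" "{\<omega> \<in> \<Omega>. ereal t < T \<omega>} \<in> sets (\<F> \<infinity>)"
  shows "survival Q T t = measure (killed_law Q T t) (space E)"
  using emeasure_killed_law[OF assms sets.top] by (simp add: survival_def measure_def space_E)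

lemma integral_cond_law:
  fixes f :: "'e \<Rightarrow> real"
  assumes Q [measurable_cong]: "sets Q = sets (\<F> \<infinity>)" and fin: "finite_measure Q"
    and t [measurable]: "t \<in> I" and N [measurable]: "{\<omega> \<in> \<Omega>. ereal t < T \<omega>} \<in> sets (\<F> \<infinity>)"
    and f [measurable]: "f \<in> borel_measurable E" and pos: "0 < survival Q T t"
  shows "(\<integral>y. f y \<partial>cond_law Q T t) = (\<integral>y. f y \<partial>killed_law Q T t) / survival Q T t"
proof -
  interpret finite_measure Q by fact
  let ?D = "{\<omega> \<in> \<Omega>. ereal t < T \<omega>}"
  \<comment> \<open>Positive survival probability allows the extended quotient to be written as a
    real density, as the integral formula for densities demands.\<close>
  have "uniform_measure Q ?D = density Q (\<lambda>\<omega>. ennreal (indicator ?D \<omega> / measure Q ?D))"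
    unfolding uniform_measure_def emeasure_eq_measure
    using pos by (intro density_cong)
      (auto simp: survival_def divide_ennreal[symmetric] simp flip: ennreal_indicator)
  then have "(\<integral>y. f y \<partial>cond_law Q T t) = (\<integral>\<omega>. (indicator ?D \<omega> / measure Q ?D) *\<^sub>R f (X t \<omega>) \<partial>Q)"
    unfolding cond_law_def by (subst integral_distr; (simp, subst integral_density)?; measurable)
  moreover have "(\<integral>y. f y \<partial>killed_law Q T t) = (\<integral>\<omega>. indicator ?D \<omega> *\<^sub>R f (X t \<omega>) \<partial>Q)"
    unfolding killed_law_def ennreal_indicator[symmetric]
    by (subst integral_distr; (subst integral_density)?; measurable)
  ultimately show ?thesis by (simp add: survival_def)
qed

lemma measure_cond_law:
  assumes "sets Q = sets (\<F> \<infinity>)" "finite_measure Q" "t \<in> I" "{\<omega> \<in> \<Omega>. ereal t < T \<omega>} \<in> sets (\<F> \<infinity>)"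
    and "C \<in> sets E" "0 < survival Q T t"
  shows "measure (cond_law Q T t) C = measure (killed_law Q T t) C / survival Q T t"
proof -
  have "C \<inter> space (cond_law Q T t) = C" "C \<inter> space (killed_law Q T t) = C"
    by (auto simp: cond_law_def space_E)
  moreover have "indicator C \<in> borel_measurable E" using assms by simp
  ultimately show ?thesis
    using integral_cond_law[OF assms(1-4), of "indicator C"] assms by simp
qed

lemma prob_space_cond_law:
  assumes "sets Q = sets (\<F> \<infinity>)" "finite_measure Q" "t \<in> I" "{\<omega> \<in> \<Omega>. ereal t < T \<omega>} \<in> sets (\<F> \<infinity>)"
    and "0 < survival Q T t"
  shows "prob_space (cond_law Q T t)"
proof -
  note [measurable_cong] = assms(1)
  interpret finite_measure Q by fact
  have [simp]: "emeasure Q {\<omega> \<in> \<Omega>. ereal t < T \<omega>} \<noteq> 0" "emeasure Q {\<omega> \<in> \<Omega>. ereal t < T \<omega>} \<noteq> \<infinity>"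
    using assms by (auto simp: survival_def emeasure_eq_measure)
  show ?thesis
    unfolding cond_law_def using assms(3)
    by (intro prob_space.prob_space_distr prob_space_uniform_measure) auto
qed

lemma prob_space_law_from:
  assumes "s \<in> I" "\<mu> \<in> space (prob_algebra E)"
  shows "prob_space (law_from s \<mu>)" "sets (law_from s \<mu>) = sets (\<F> \<infinity>)"
  unfolding law_from_def
  using prob_space_bind'[OF assms(2) kernel[OF assms(1)]] sets_bind'[OF assms(2) kernel[OF assms(1)]] by auto

section \<open>Decomposition of killed laws in time and over the initial law\<close>

lemma less_hit_from_split:
  assumes "0 \<le> r"
  shows "ereal (t + r) < hit_from 0 D \<omega> \<longleftrightarrow> ereal t < hit_from 0 D \<omega> \<and> ereal (t + r) < hit_from t D \<omega>"
proof safe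
  assume "ereal (t + r) < hit_from 0 D \<omega>"
  then obtain e where "e > 0" "\<forall>u\<in>I. 0 \<le> u \<longrightarrow> X u \<omega> \<in> D u \<longrightarrow> t + r + e \<le> u"
    unfolding less_hit_from_iff by blast
  then show "ereal t < hit_from 0 D \<omega>" "ereal (t + r) < hit_from t D \<omega>"
    unfolding less_hit_from_iff using assms time_nonneg by (force intro: exI[of _ e])+
next
  assume "ereal t < hit_from 0 D \<omega>" "ereal (t + r) < hit_from t D \<omega>"
  then obtain d e where de: "d > 0" "\<forall>u\<in>I. 0 \<le> u \<longrightarrow> X u \<omega> \<in> D u \<longrightarrow> t + d \<le> u"
    "e > 0" "\<forall>u\<in>I. t \<le> u \<longrightarrow> X u \<omega> \<in> D u \<longrightarrow> t + r + e \<le> u"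
    unfolding less_hit_from_iff by blast
  \<comment> \<open>The first gap \<open>d\<close> excludes hits up to time \<open>t\<close>, so
    \<open>t \<le> u\<close> and the second gap \<open>e\<close> applies.\<close>
  have "t + r + e \<le> u" if "u \<in> I" "0 \<le> u" "X u \<omega> \<in> D u" for u
  proof -
    have "t + d \<le> u" using de that by blast
    then show ?thesis using de that by auto
  qed
  with de(3) show "ereal (t + r) < hit_from 0 D \<omega>"
    unfolding less_hit_from_iff by blast
qed

lemma killed_law_shift:
  assumes s: "s \<in> I" and t: "t \<in> I"
    and N: "{\<omega> \<in> \<Omega>. ereal t < hit_from 0 (\<lambda>u. D (s + u)) \<omega>} \<in> sets (\<F> \<infinity>)"
  shows "{\<omega> \<in> \<Omega>. ereal (s + t) < hit_from s D \<omega>} \<in> sets (\<F> \<infinity>)"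
    and "killed_law (P s x) (hit_from s D) (s + t) = killed_law (P 0 x) (hit_from 0 (\<lambda>u. D (s + u))) t"
proof -
  \<comment> \<open>With the whole space as target the position constraint is trivial, so the
    survival event itself is a path event.\<close>
  show ev: "{\<omega> \<in> \<Omega>. ereal (s + t) < hit_from s D \<omega>} \<in> sets (\<F> \<infinity>)"
  proof (rule shifted_event[OF s t sets.top N])
    fix B assume "B \<in> sets path_algebra"
      "{\<omega> \<in> \<Omega>. ereal (s + t) < hit_from s D \<omega> \<and> X (s + t) \<omega> \<in> space E} = {\<omega> \<in> \<Omega>. path_from s \<omega> \<in> B}"
    then show ?thesis using path_event[OF s] by (simp add: space_E)
  qed
  show "killed_law (P s x) (hit_from s D) (s + t) = killed_law (P 0 x) (hit_from 0 (\<lambda>u. D (s + u))) t"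
  proof (rule measure_eqI)
    fix C assume "C \<in> sets (killed_law (P s x) (hit_from s D) (s + t))"
    then have C: "C \<in> sets E" by simp
    obtain B where B: "B \<in> sets path_algebra"
      "{\<omega> \<in> \<Omega>. ereal t < hit_from 0 (\<lambda>u. D (s + u)) \<omega> \<and> X t \<omega> \<in> C} = {\<omega> \<in> \<Omega>. path_from 0 \<omega> \<in> B}"
      "{\<omega> \<in> \<Omega>. ereal (s + t) < hit_from s D \<omega> \<and> X (s + t) \<omega> \<in> C} = {\<omega> \<in> \<Omega>. path_from s \<omega> \<in> B}"
      by (rule shifted_event[OF s t C N])
    show "emeasure (killed_law (P s x) (hit_from s D) (s + t)) C
        = emeasure (killed_law (P 0 x) (hit_from 0 (\<lambda>u. D (s + u))) t) C"
      using homogeneous_event[OF s B(1), of x]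
        emeasure_killed_law[OF sets_P[OF s] time_add[OF s t] ev C, of x]
        emeasure_killed_law[OF sets_P[OF time_0] t N C, of x] B
      by simp
  qed simp
qed

text \<open>Chapman-Kolmogorov with killing: after time \<open>t\<close> the process restarts from
  its position and meets the boundary advanced by \<open>t\<close>. The survival event up to
  \<open>t\<close> must lie in \<open>\<F> (ereal t)\<close> for the Markov property at
  \<open>t\<close>; the later one becomes a path event.\<close>

lemma killed_law_semigroup:
  assumes t: "t \<in> I" and r: "r \<in> I"
    and N: "{\<omega> \<in> \<Omega>. ereal t < hit_from 0 D \<omega>} \<in> sets (\<F> (ereal t))"
    and M: "{\<omega> \<in> \<Omega>. ereal r < hit_from 0 (\<lambda>u. D (t + u)) \<omega>} \<in> sets (\<F> \<infinity>)"
  shows "killed_law (P 0 x) (hit_from 0 D) (t + r)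
    = killed_law (P 0 x) (hit_from 0 D) t \<bind> (\<lambda>y. killed_law (P 0 y) (hit_from 0 (\<lambda>u. D (t + u))) r)"
proof (rule measure_eqI)
  let ?K = "killed_law (P 0 x) (hit_from 0 D) t"
  let ?L = "\<lambda>y. killed_law (P 0 y) (hit_from 0 (\<lambda>u. D (t + u))) r"
  have L: "?L \<in> E \<rightarrow>\<^sub>M subprob_algebra E" by (rule killed_law_kernel[OF r M])
  have L': "?L \<in> ?K \<rightarrow>\<^sub>M subprob_algebra E" using L by (simp cong: measurable_cong_sets)
  show "sets (killed_law (P 0 x) (hit_from 0 D) (t + r)) = sets (?K \<bind> ?L)"
    using sets_bind[of ?K ?L E] by (simp add: space_E)
  have N': "{\<omega> \<in> \<Omega>. ereal t < hit_from 0 D \<omega>} \<in> sets (\<F> \<infinity>)"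
    using N sets_F_mono[of "ereal t" \<infinity>] by auto
  have split: "{\<omega> \<in> \<Omega>. ereal (t + r) < hit_from 0 D \<omega>}
      = {\<omega> \<in> \<Omega>. ereal t < hit_from 0 D \<omega>} \<inter> {\<omega> \<in> \<Omega>. ereal (t + r) < hit_from t D \<omega>}"
    using less_hit_from_split[OF time_nonneg[OF r]] by blast
  then have NM: "{\<omega> \<in> \<Omega>. ereal (t + r) < hit_from 0 D \<omega>} \<in> sets (\<F> \<infinity>)"
    using N' killed_law_shift(1)[OF t r M] by simp
  fix C assume "C \<in> sets (killed_law (P 0 x) (hit_from 0 D) (t + r))"
  then have C [measurable]: "C \<in> sets E" by simp
  obtain B where B: "B \<in> sets path_algebra"
    "{\<omega> \<in> \<Omega>. ereal r < hit_from 0 (\<lambda>u. D (t + u)) \<omega> \<and> X r \<omega> \<in> C} = {\<omega> \<in> \<Omega>. path_from 0 \<omega> \<in> B}"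
    "{\<omega> \<in> \<Omega>. ereal (t + r) < hit_from t D \<omega> \<and> X (t + r) \<omega> \<in> C} = {\<omega> \<in> \<Omega>. path_from t \<omega> \<in> B}"
    by (rule shifted_event[OF t r C M])
  have "emeasure (killed_law (P 0 x) (hit_from 0 D) (t + r)) C
      = emeasure (P 0 x) {\<omega> \<in> \<Omega>. ereal (t + r) < hit_from 0 D \<omega> \<and> X (t + r) \<omega> \<in> C}"
    by (rule emeasure_killed_law[OF sets_P[OF time_0] time_add[OF t r] NM C])
  also have "{\<omega> \<in> \<Omega>. ereal (t + r) < hit_from 0 D \<omega> \<and> X (t + r) \<omega> \<in> C}
      = {\<omega> \<in> \<Omega>. ereal t < hit_from 0 D \<omega>} \<inter> {\<omega> \<in> \<Omega>. path_from t \<omega> \<in> B}"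
    using split B(3) by blast
  also have "emeasure (P 0 x) \<dots> = (\<integral>\<^sup>+\<omega>. indicator {\<omega> \<in> \<Omega>. ereal t < hit_from 0 D \<omega>} \<omega>
      * emeasure (P 0 (X t \<omega>)) {\<omega>' \<in> \<Omega>. path_from 0 \<omega>' \<in> B} \<partial>P 0 x)"
    by (rule markov_event[OF t N B(1)])
  also have "\<dots> = (\<integral>\<^sup>+\<omega>. indicator {\<omega> \<in> \<Omega>. ereal t < hit_from 0 D \<omega>} \<omega>
      * emeasure (?L (X t \<omega>)) C \<partial>P 0 x)"
    using emeasure_killed_law[OF sets_P[OF time_0] r M C] B(2) by simp
  also have "\<dots> = (\<integral>\<^sup>+y. emeasure (?L y) C \<partial>?K)"
    using measurable_emeasure_kernel[OF L C]
    by (subst nn_integral_killed_law[OF sets_P[OF time_0] t N']) auto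
  also have "\<dots> = emeasure (?K \<bind> ?L) C"
    by (rule emeasure_bind[OF _ L' C, symmetric]) (simp add: space_E)
  finally show "emeasure (killed_law (P 0 x) (hit_from 0 D) (t + r)) C = emeasure (?K \<bind> ?L) C" .
qed

text \<open>Linearity in the underlying measure: on every set both sides are the
  \<open>\<mu>\<close>-average of the same probabilities.\<close>

lemma killed_law_law_from:
  assumes s: "s \<in> I" and \<mu>: "\<mu> \<in> space (prob_algebra E)" and t: "t \<in> I"
    and N: "{\<omega> \<in> \<Omega>. ereal t < T \<omega>} \<in> sets (\<F> \<infinity>)"
    and K: "(\<lambda>x. killed_law (P s x) T t) \<in> E \<rightarrow>\<^sub>M subprob_algebra E"
  shows "killed_law (law_from s \<mu>) T t = \<mu> \<bind> (\<lambda>x. killed_law (P s x) T t)"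
proof (rule measure_eqI)
  have [measurable_cong]: "sets \<mu> = sets E" using \<mu> by (simp add: space_prob_algebra)
  have sp: "space \<mu> \<noteq> {}" using sets_eq_imp_space_eq[OF \<open>sets \<mu> = sets E\<close>] by (simp add: space_E)
  have K': "(\<lambda>x. killed_law (P s x) T t) \<in> \<mu> \<rightarrow>\<^sub>M subprob_algebra E"
    using K by (simp cong: measurable_cong_sets)
  show "sets (killed_law (law_from s \<mu>) T t) = sets (\<mu> \<bind> (\<lambda>x. killed_law (P s x) T t))"
    using sp by (subst sets_bind[of _ _ E]) auto
  fix C assume "C \<in> sets (killed_law (law_from s \<mu>) T t)"
  then have C: "C \<in> sets E" by simp
  have "emeasure (killed_law (law_from s \<mu>) T t) C
      = emeasure (\<mu> \<bind> P s) {\<omega> \<in> \<Omega>. ereal t < T \<omega> \<and> X t \<omega> \<in> C}"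
    unfolding law_from_def[symmetric]
    by (rule emeasure_killed_law[OF prob_space_law_from(2)[OF s \<mu>] t N C])
  also have "\<dots> = (\<integral>\<^sup>+x. emeasure (P s x) {\<omega> \<in> \<Omega>. ereal t < T \<omega> \<and> X t \<omega> \<in> C} \<partial>\<mu>)"
    by (rule emeasure_bind_prob_algebra[OF \<mu> kernel[OF s] killed_event_measurable[OF t N C]])
  also have "\<dots> = (\<integral>\<^sup>+x. emeasure (killed_law (P s x) T t) C \<partial>\<mu>)"
    by (simp add: emeasure_killed_law[OF sets_P[OF s] t N C])
  also have "\<dots> = emeasure (\<mu> \<bind> (\<lambda>x. killed_law (P s x) T t)) C"
    by (rule emeasure_bind[OF sp K' C, symmetric])
  finally show "emeasure (killed_law (law_from s \<mu>) T t) C = emeasure (\<mu> \<bind> (\<lambda>x. killed_law (P s x) T t)) C" .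
qed

end

section \<open>Moving boundaries\<close>

context moving_boundary_process
begin

text \<open>
  By homogeneity the process started at time \<open>s\<close> is realised under \<open>P 0 x\<close> with the boundary shifted
  by \<open>s\<close>, so that all killed laws live under the measures \<open>P 0 x\<close>.
\<close>

definition clock :: "real \<Rightarrow> 'w \<Rightarrow> ereal" where
  "clock s = hit_from 0 (\<lambda>u. A (s + u))"

definition killed :: "real \<Rightarrow> real \<Rightarrow> 'e \<Rightarrow> 'e measure" where
  "killed s t x = killed_law (P 0 x) (clock s) t"

definition killed_inf :: "real \<Rightarrow> 'e \<Rightarrow> 'e measure" where
  "killed_inf t x = killed_law (P 0 x) tau_inf t"

section \<open>Killed kernels of the moving boundary\<close>

lemma clock_event:
  assumes "s \<in> I"
  shows "{\<omega> \<in> \<Omega>. ereal t < clock s \<omega>} \<in> sets (\<F> (ereal t))" "{\<omega> \<in> \<Omega>. ereal t < clock s \<omega>} \<in> sets (\<F> \<infinity>)"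
proof -
  show "{\<omega> \<in> \<Omega>. ereal t < clock s \<omega>} \<in> sets (\<F> (ereal t))"
    using stopping_timeD2[OF tau_stopping[OF assms], of "ereal t"] by (simp add: pred_def clock_def)
  then show "{\<omega> \<in> \<Omega>. ereal t < clock s \<omega>} \<in> sets (\<F> \<infinity>)"
    using sets_F_mono[of "ereal t" \<infinity>] by auto
qed

lemma tau_inf_event: "{\<omega> \<in> \<Omega>. ereal t < tau_inf \<omega>} \<in> sets (\<F> \<infinity>)"
  using stopping_timeD2[OF tau_inf_stopping, of "ereal t"] sets_F_mono[of "ereal t" \<infinity>]
  by (auto simp: pred_def)

lemma sets_killed [simp, measurable_cong]: "sets (killed s t x) = sets E" "sets (killed_inf t x) = sets E"
  by (simp_all add: killed_def killed_inf_def)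

lemma space_killed [simp]: "space (killed s t x) = space E" "space (killed_inf t x) = space E"
  by (simp_all add: killed_def killed_inf_def)

lemma tau_event:
  assumes "s \<in> I" "t \<in> I"
  shows "{\<omega> \<in> \<Omega>. ereal (s + t) < tau s \<omega>} \<in> sets (\<F> \<infinity>)"
  unfolding tau_def using assms clock_event by (intro killed_law_shift) (auto simp: clock_def)

lemma killed_law_tau:
  assumes "s \<in> I" "t \<in> I"
  shows "killed_law (P s x) (tau s) (s + t) = killed s t x"
  unfolding tau_def killed_def clock_def
  using assms clock_event by (intro killed_law_shift) (auto simp: clock_def)

lemma survival_killed:
  assumes "s \<in> I" "t \<in> I"
  shows "survival (P s x) (tau s) (s + t) = measure (killed s t x) (space E)"
  using assms by (simp add: survival_eq_killed_law tau_event time_add killed_law_tau)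

lemma killed_kernel [measurable]:
  "s \<in> I \<Longrightarrow> t \<in> I \<Longrightarrow> killed s t \<in> E \<rightarrow>\<^sub>M subprob_algebra E"
  using killed_law_kernel[OF _ clock_event(2)] by (simp add: killed_def[abs_def])

lemma killed_subprob: "s \<in> I \<Longrightarrow> t \<in> I \<Longrightarrow> subprob_space (killed s t x)"
  using measurable_space[OF killed_kernel, of s t x] by (simp add: space_E space_subprob_algebra)

lemma killed_inf_subprob: "t \<in> I \<Longrightarrow> subprob_space (killed_inf t x)"
  using measurable_space[OF killed_law_kernel[OF _ tau_inf_event], of t x]
  by (simp add: space_E space_subprob_algebra killed_inf_def)

lemma killed_semigroup:
  assumes "s \<in> I" "t \<in> I" "r \<in> I"
  shows "killed s (t + r) x = killed s t x \<bind> killed (s + t) r"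
proof -
  have "killed_law (P 0 x) (hit_from 0 (\<lambda>u. A (s + u))) (t + r)
    = killed_law (P 0 x) (hit_from 0 (\<lambda>u. A (s + u))) t
      \<bind> (\<lambda>y. killed_law (P 0 y) (hit_from 0 (\<lambda>u. A (s + (t + u)))) r)"
    using assms clock_event(1)[OF assms(1), of t] clock_event(2)[OF time_add[OF assms(1,2)], of r]
    by (intro killed_law_semigroup) (simp_all add: clock_def add.assoc)
  then show ?thesis by (simp add: killed_def[abs_def] clock_def add.assoc)
qed

lemma killed_alive:
  assumes s: "s \<in> I" and t: "t \<in> I"
  shows "AE y in killed s t x. y \<in> alive (s + t)"
proof -
  have A: "A (s + t) \<in> sets E" using A_sets time_add s t by blast
  \<comment> \<open>A position in \<open>A (s + t)\<close> at time \<open>t\<close> would itself be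
    a hit, contradicting the gap condition, which would read \<open>t + e \<le> t\<close>.\<close>
  have empty: "{\<omega> \<in> \<Omega>. ereal t < clock s \<omega> \<and> X t \<omega> \<in> A (s + t)} = {}"
    using t time_nonneg[OF t] unfolding clock_def less_hit_from_iff by force
  have "emeasure (killed s t x) (A (s + t))
      = emeasure (P 0 x) {\<omega> \<in> \<Omega>. ereal t < clock s \<omega> \<and> X t \<omega> \<in> A (s + t)}"
    using s t A by (simp add: killed_def emeasure_killed_law clock_event)
  then have "emeasure (killed s t x) (A (s + t)) = 0"
    by (simp only: empty emeasure_empty)
  then show ?thesis
    using A by (intro AE_I[of _ _ "A (s + t)"]) (auto simp: alive_def)
qed

lemma integral_killed_measurable [measurable]:
  fixes f :: "'e \<Rightarrow> real"
  assumes "s \<in> I" "t \<in> I" "f \<in> borel_measurable E"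
  shows "(\<lambda>y. \<integral>z. f z \<partial>killed s t y) \<in> borel_measurable E"
  using measurable_compose[OF killed_kernel[OF assms(1,2)] integral_measurable_subprob_algebra[OF assms(3)]] .

lemma integral_killed_bound:
  fixes f :: "'e \<Rightarrow> real"
  assumes "s \<in> I" "t \<in> I" and f: "f \<in> borel_measurable E" "\<And>x. \<bar>f x\<bar> \<le> 1"
  shows "\<bar>\<integral>z. f z \<partial>killed s t x\<bar> \<le> measure (killed s t x) (space E)"
    and "measure (killed s t x) (space E) \<le> 1"
proof -
  interpret subprob_space "killed s t x" using assms by (intro killed_subprob)
  have "\<bar>\<integral>z. f z \<partial>killed s t x\<bar> \<le> (\<integral>z. \<bar>f z\<bar> \<partial>killed s t x)" by (rule integral_abs_bound)
  also have "\<dots> \<le> (\<integral>z. 1 \<partial>killed s t x)"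
    using f by (intro integral_mono integrable_const_bound[of _ 1]) auto
  finally show "\<bar>\<integral>z. f z \<partial>killed s t x\<bar> \<le> measure (killed s t x) (space E)" by simp
  show "measure (killed s t x) (space E) \<le> 1"
    using subprob_measure_le_1 .
qed

lemma integral_killed_add:
  fixes f :: "'e \<Rightarrow> real"
  assumes "s \<in> I" "t \<in> I" "r \<in> I" and f: "f \<in> borel_measurable E" "\<And>x. \<bar>f x\<bar> \<le> 1"
  shows "(\<integral>z. f z \<partial>killed s (t + r) x) = (\<integral>y. (\<integral>z. f z \<partial>killed (s + t) r y) \<partial>killed s t x)"
proof -
  interpret subprob_space "killed s t x" using assms by (intro killed_subprob)
  have "subprob_space (killed (s + t) r y)" for y using assms by (intro killed_subprob time_add)
  then have b: "emeasure (killed (s + t) r y) (space (killed (s + t) r y)) \<le> ennreal 1" for y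
    using subprob_space.emeasure_space_le_1[of "killed (s + t) r y"] by simp
  have k: "killed (s + t) r \<in> killed s t x \<rightarrow>\<^sub>M subprob_algebra E"
    using killed_kernel[OF time_add[OF assms(1,2)] assms(3)] by (simp cong: measurable_cong_sets)
  show ?thesis
    unfolding killed_semigroup[OF assms(1-3)]
    by (rule integral_bind[where B' = 1, OF f(1) f(2) k finite_measure_axioms]) (use b in auto)
qed

lemma integral_killed_law_from:
  fixes f :: "'e \<Rightarrow> real"
  assumes "s \<in> I" "t \<in> I" and \<mu>: "\<mu> \<in> space (prob_algebra E)"
    and f: "f \<in> borel_measurable E" "\<And>x. \<bar>f x\<bar> \<le> 1"
  shows "(\<integral>z. f z \<partial>killed_law (law_from s \<mu>) (tau s) (s + t)) = (\<integral>y. (\<integral>z. f z \<partial>killed s t y) \<partial>\<mu>)"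
proof -
  have \<mu>': "sets \<mu> = sets E" "prob_space \<mu>" using \<mu> by (auto simp: space_prob_algebra)
  interpret prob_space \<mu> by (rule \<mu>')
  have "subprob_space (killed s t y)" for y using assms by (intro killed_subprob time_add)
  then have b: "emeasure (killed s t y) (space (killed s t y)) \<le> ennreal 1" for y
    using subprob_space.emeasure_space_le_1[of "killed s t y"] by simp
  have k: "killed s t \<in> \<mu> \<rightarrow>\<^sub>M subprob_algebra E"
    using killed_kernel[OF assms(1,2)] \<mu>' by (simp cong: measurable_cong_sets)
  have "killed_law (law_from s \<mu>) (tau s) (s + t) = \<mu> \<bind> killed s t"
    using killed_law_law_from[OF assms(1) \<mu> time_add[OF assms(1,2)] tau_event[OF assms(1,2)]]
      killed_kernel[OF assms(1,2)] by (simp add: killed_law_tau[OF assms(1,2)])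
  then show ?thesis
    using integral_bind[OF f(1) f(2) k finite_measure_axioms, of 1] b by auto
qed

lemma survival_law_from:
  assumes "s \<in> I" "t \<in> I" and \<mu>: "\<mu> \<in> space (prob_algebra E)"
  shows "survival (law_from s \<mu>) (tau s) (s + t) = (\<integral>y. measure (killed s t y) (space E) \<partial>\<mu>)"
  using integral_killed_law_from[OF assms, of "\<lambda>_. 1"] prob_space_law_from[OF assms(1) \<mu>]
  by (simp add: survival_eq_killed_law time_add tau_event assms)


section \<open>Contraction of expectations conditioned on survival\<close>

lemma prob_on_aliveD:
  assumes "\<nu> \<in> prob_on E (alive s)"
  shows "AE y in \<nu>. y \<in> alive s" "prob_space \<nu>" "sets \<nu> = sets E" "alive s \<noteq> {}" "\<nu> \<in> space (prob_algebra E)"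
proof -
  show \<nu>: "prob_space \<nu>" "sets \<nu> = sets E" "\<nu> \<in> space (prob_algebra E)"
    using assms by (auto simp: prob_on_def space_prob_algebra)
  interpret prob_space \<nu> by fact
  have 1: "emeasure \<nu> (alive s) = 1" using assms by (simp add: prob_on_def)
  \<comment> \<open>Non-measurable sets have measure 0 by convention, so full mass forces
    measurability.\<close>
  then have "alive s \<in> events" by (intro emeasure_neq_0_sets) simp
  with 1 show "AE y in \<nu>. y \<in> alive s"
    by (subst AE_in_set_eq_1) (auto simp: emeasure_eq_measure)
  show "alive s \<noteq> {}" using 1 by auto
qed

lemma killed_pos:
  assumes "s \<in> I" "t \<in> I" "x \<in> alive s"
  shows "0 < measure (killed s t x) (space E)"
  using survival_pos[OF assms(1) time_add[OF assms(1,2)] _ assms(3)] time_nonneg[OF assms(2)] assms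
  by (simp add: survival_killed)

text \<open>Integral over mass is the expectation conditioned on survival, so \<open>[a, b]\<close>
  encloses its values over all surviving starting points; multiplied out, the bounds can be
  integrated. The induction prepends a period: the hypothesis at \<open>s + t0\<close> controls
  \<open>g\<close> and \<open>h\<close>, and \<open>doeblin_contraction\<close> is applied to the
  killed law of the first period. The new endpoints involve \<open>\<nu> (s + t0)\<close> but not
  \<open>x\<close>.\<close>

lemma oscillation_contraction:
  fixes f :: "'e \<Rightarrow> real"
  assumes \<nu>: "\<And>s. s \<in> I \<Longrightarrow> \<nu> s \<in> prob_on E (alive s)"
    and t0: "t0 \<in> I" and c: "0 < c1" "0 < c2" "c1 * c2 \<le> 1"
    and minor: "\<And>s x B. s \<in> I \<Longrightarrow> x \<in> alive s \<Longrightarrow> B \<in> sets E \<Longrightarrow>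
         c1 * measure (\<nu> (s + t0)) B \<le> measure (cond_law (P s x) (tau s) (s + t0)) B"
    and dominated: "\<And>s t x. s \<in> I \<Longrightarrow> t \<in> I \<Longrightarrow> s \<le> t \<Longrightarrow> x \<in> alive s \<Longrightarrow>
         c2 * survival (P s x) (tau s) t \<le> survival (law_from s (\<nu> s)) (tau s) t"
    and f: "f \<in> borel_measurable E" "\<And>x. \<bar>f x\<bar> \<le> 1" and s: "s \<in> I"
  shows "\<exists>a b. b - a \<le> 2 * (1 - c1 * c2) ^ n \<and>
    (\<forall>x\<in>alive s. a * measure (killed s (n * t0) x) (space E) \<le> (\<integral>z. f z \<partial>killed s (n * t0) x) \<and>
       (\<integral>z. f z \<partial>killed s (n * t0) x) \<le> b * measure (killed s (n * t0) x) (space E))"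
  using s
proof (induction n arbitrary: s)
  \<comment> \<open>Since \<open>\<bar>f x\<bar> \<le> 1\<close>, the interval
    \<open>[-1, 1]\<close> works; its length is the constant 2 of the bound.\<close>
  case 0
  then show ?case
    using integral_killed_bound(1)[OF 0 time_0 f] by (intro exI[of _ "-1"] exI[of _ 1]) (auto simp: abs_le_iff minus_le_iff)
next
  case (Suc n)
  let ?t = "real n * t0" and ?s = "s + t0"
  define g where "g y = (\<integral>z. f z \<partial>killed ?s ?t y)" for y
  define h where "h y = measure (killed ?s ?t y) (space E)" for y
  have sI: "s \<in> I" "?s \<in> I" and tI: "?t \<in> I" using Suc t0 by (auto intro: time_add time_of_nat_mult)
  have Suc_t: "real (Suc n) * t0 = t0 + ?t" by (simp add: algebra_simps)
  obtain a b where ab: "b - a \<le> 2 * (1 - c1 * c2) ^ n"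
    "\<And>y. y \<in> alive ?s \<Longrightarrow> a * h y \<le> g y \<and> g y \<le> b * h y"
    using Suc.IH[OF sI(2)] unfolding g_def h_def by blast
  note \<nu>' = prob_on_aliveD[OF \<nu>[OF sI(2)]]
  have h_eq: "h y = (\<integral>z. 1 \<partial>killed ?s ?t y)" for y by (simp add: h_def)
  have gh [measurable]: "g \<in> borel_measurable E" "h \<in> borel_measurable E"
    unfolding g_def[abs_def] h_eq[abs_def] using sI tI f by measurable
  have h_bound: "\<bar>h y\<bar> \<le> 1" "\<bar>g y\<bar> \<le> 1" for y
    using integral_killed_bound[OF sI(2) tI f, of y] by (auto simp: h_def g_def)
  have dom: "c2 * h y \<le> (\<integral>z. h z \<partial>\<nu> ?s)" if "y \<in> alive ?s" for y
    using dominated[OF sI(2) time_add[OF sI(2) tI] _ that] time_nonneg[OF tI]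
    by (simp add: survival_killed[OF sI(2) tI] survival_law_from[OF sI(2) tI \<nu>'(5)] h_def)
  \<comment> \<open>Any surviving \<open>y\<close> has positive survival probability, and domination
    passes this on to the mean under \<open>\<nu> ?s\<close>.\<close>
  have pos: "0 < (\<integral>z. h z \<partial>\<nu> ?s)"
  proof -
    obtain y where "y \<in> alive ?s" using \<nu>'(4) by blast
    then have "0 < c2 * h y" using killed_pos[OF sI(2) tI] c by (simp add: h_def)
    then show ?thesis using dom[OF \<open>y \<in> alive ?s\<close>] by linarith
  qed
  define p where "p = (\<integral>y. g y \<partial>\<nu> ?s) / (\<integral>y. h y \<partial>\<nu> ?s)"
  have step: "(a + c1 * c2 * (p - a)) * (\<integral>y. h y \<partial>killed s t0 x) \<le> (\<integral>y. g y \<partial>killed s t0 x) \<and>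
      (\<integral>y. g y \<partial>killed s t0 x) \<le> (b - c1 * c2 * (b - p)) * (\<integral>y. h y \<partial>killed s t0 x)"
    if x: "x \<in> alive s" for x
  proof -
    interpret K: subprob_space "killed s t0 x" using killed_subprob[OF sI(1) t0] .
    have alive: "AE y in killed s t0 x. y \<in> alive ?s" by (rule killed_alive[OF sI(1) t0])
    have mpos: "0 < measure (killed s t0 x) (space E)" by (rule killed_pos[OF sI(1) t0 x])
    \<comment> \<open>The minorization in (A'1) concerns the conditional law; clearing its
      denominator, the mass of the killed law, gives the required form.\<close>
    have min: "c1 * measure (killed s t0 x) (space (killed s t0 x)) * measure (\<nu> ?s) B \<le> measure (killed s t0 x) B"
      if "B \<in> sets (\<nu> ?s)" for B
    proof -
      have B: "B \<in> sets E" using that \<nu>' by simp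
      interpret PS: prob_space "P s x" by (rule prob_space_P[OF sI(1)])
      have "measure (cond_law (P s x) (tau s) (s + t0)) B = measure (killed s t0 x) B / measure (killed s t0 x) (space E)"
        using measure_cond_law[OF sets_P[OF sI(1)] PS.finite_measure_axioms sI(2) tau_event[OF sI(1) t0] B]
          survival_killed[OF sI(1) t0] killed_law_tau[OF sI(1) t0] mpos by simp
      then show ?thesis using minor[OF sI(1) x B] mpos by (simp add: pos_le_divide_eq mult_ac)
    qed
    have "sets (killed s t0 x) = sets (\<nu> ?s)" using \<nu>' by simp
    note contraction = doeblin_contraction[OF K.finite_measure_axioms \<nu>'(2) this _ _ min, of c2 g h a b, folded p_def]
    have m: "g \<in> borel_measurable (\<nu> ?s)" "h \<in> borel_measurable (\<nu> ?s)"
      using gh \<nu>'(3) by (simp_all cong: measurable_cong_sets)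
    have ae: "AE x in killed s t0 x. a * h x \<le> g x \<and> g x \<le> b * h x" "AE x in \<nu> ?s. a * h x \<le> g x \<and> g x \<le> b * h x"
      "AE y in killed s t0 x. c2 * h y \<le> (\<integral>z. h z \<partial>\<nu> ?s)"
      using alive \<nu>'(1) ab(2) dom by (auto elim!: eventually_mono)
    show ?thesis
      using contraction[OF _ _ _ m h_bound(2) h_bound(1) ae pos] c by auto
  qed
  \<comment> \<open>\<open>p\<close> cancels from the length of the new interval.\<close>
  have "(b - c1 * c2 * (b - p)) - (a + c1 * c2 * (p - a)) = (1 - c1 * c2) * (b - a)"
    by (simp add: algebra_simps)
  also have "\<dots> \<le> (1 - c1 * c2) * (2 * (1 - c1 * c2) ^ n)"
    using ab(1) c(3) by (intro mult_left_mono) auto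
  finally have "(b - c1 * c2 * (b - p)) - (a + c1 * c2 * (p - a)) \<le> 2 * (1 - c1 * c2) ^ Suc n" by simp
  moreover have "(\<integral>z. f z \<partial>killed s (real (Suc n) * t0) x) = (\<integral>y. g y \<partial>killed s t0 x)" for x
    unfolding Suc_t g_def by (rule integral_killed_add[OF sI(1) t0 tI f])
  \<comment> \<open>The mass composes like an integral, as the case of the constant test function
    1.\<close>
  moreover have "measure (killed s (real (Suc n) * t0) x) (space E) = (\<integral>y. h y \<partial>killed s t0 x)" for x
    unfolding Suc_t using integral_killed_add[OF sI(1) t0 tI, of "\<lambda>_. 1" x] by (simp add: h_def)
  ultimately show ?case using step by (intro exI conjI) auto
qed

text \<open>Splitting at time \<open>s\<close> exhibits the conditional expectation from
  \<open>\<mu>\<close> as an average, weighted by survival probabilities, of the conditional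
  expectations from points of \<open>alive s\<close>. It therefore lies in \<open>[a, b]\<close>, as
  does the one started from \<open>x\<close>.\<close>

lemma cond_law_merge:
  fixes f :: "'e \<Rightarrow> real"
  assumes \<mu>: "\<mu> \<in> prob_on E (alive 0)" and s: "s \<in> I" and t: "t \<in> I" and x: "x \<in> alive s"
    and f: "f \<in> borel_measurable E" "\<And>x. \<bar>f x\<bar> \<le> 1"
    and ab: "\<And>y. y \<in> alive s \<Longrightarrow> a * measure (killed s t y) (space E) \<le> (\<integral>z. f z \<partial>killed s t y) \<and>
       (\<integral>z. f z \<partial>killed s t y) \<le> b * measure (killed s t y) (space E)"
  shows "\<bar>(\<integral>z. f z \<partial>cond_law (law_from 0 \<mu>) (tau 0) (s + t))
    - (\<integral>z. f z \<partial>killed s t x) / measure (killed s t x) (space E)\<bar> \<le> b - a"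
proof -
  note \<mu>' = prob_on_aliveD[OF \<mu>]
  interpret prob_space \<mu> by (rule \<mu>'(2))
  interpret L: prob_space "law_from 0 \<mu>" by (rule prob_space_law_from(1)[OF time_0 \<mu>'(5)])
  have st: "s + t \<in> I" by (rule time_add[OF s t])
  define F where "F y = (\<integral>z. f z \<partial>killed 0 (s + t) y)" for y
  define M where "M y = measure (killed 0 (s + t) y) (space E)" for y
  have M_eq: "M y = (\<integral>z. 1 \<partial>killed 0 (s + t) y)" for y by (simp add: M_def)
  have "F \<in> borel_measurable E" "M \<in> borel_measurable E"
    unfolding F_def[abs_def] M_eq[abs_def] using st f by measurable
  then have [measurable]: "F \<in> borel_measurable \<mu>" "M \<in> borel_measurable \<mu>"
    using \<mu>'(3) by (simp_all cong: measurable_cong_sets)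
  have bnd: "\<bar>F y\<bar> \<le> 1" "\<bar>M y\<bar> \<le> 1" for y
    using integral_killed_bound[OF time_0 st f, of y] by (auto simp: F_def M_def)
  have int: "integrable \<mu> F" "integrable \<mu> M"
    using bnd by (auto intro!: integrable_const_bound[of _ 1])
  \<comment> \<open>The bounds \<open>ab\<close> hold only on \<open>alive s\<close>; the law killed
    up to time \<open>s\<close> is carried by that set, so they can be integrated against
    it.\<close>
  have FM: "a * M y \<le> F y \<and> F y \<le> b * M y" for y
  proof -
    interpret K: subprob_space "killed 0 s y" by (rule killed_subprob[OF time_0 s])
    define G where "G w = (\<integral>z. f z \<partial>killed s t w)" for w
    define H where "H w = measure (killed s t w) (space E)" for w
    have H_eq: "H y = (\<integral>z. 1 \<partial>killed s t y)" for y by (simp add: H_def)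
    have [measurable]: "G \<in> borel_measurable E" "H \<in> borel_measurable E"
      unfolding G_def[abs_def] H_eq[abs_def] using s t f by measurable
    have "\<bar>G y\<bar> \<le> 1" "\<bar>H y\<bar> \<le> 1" for y
      using integral_killed_bound[OF s t f, of y] by (auto simp: G_def H_def)
    then have i: "integrable (killed 0 s y) G" "integrable (killed 0 s y) H"
      by (auto intro!: K.integrable_const_bound[of _ 1])
    have FG: "F y = (\<integral>w. G w \<partial>killed 0 s y)" "M y = (\<integral>w. H w \<partial>killed 0 s y)"
      using integral_killed_add[OF time_0 s t f, of y] integral_killed_add[OF time_0 s t, of "\<lambda>_. 1" y]
      by (simp_all add: F_def G_def M_def H_def)
    have ae: "AE w in killed 0 s y. a * H w \<le> G w" "AE w in killed 0 s y. G w \<le> b * H w"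
      using killed_alive[OF time_0 s, of y] ab by (auto simp: G_def H_def elim!: eventually_mono)
    have "(\<integral>w. a * H w \<partial>killed 0 s y) \<le> (\<integral>w. G w \<partial>killed 0 s y)"
      "(\<integral>w. G w \<partial>killed 0 s y) \<le> (\<integral>w. b * H w \<partial>killed 0 s y)"
      by (intro integral_mono_AE ae integrable_mult_right i)+
    then show ?thesis by (simp add: FG)
  qed
  have "(\<integral>y. a * M y \<partial>\<mu>) \<le> (\<integral>y. F y \<partial>\<mu>)" "(\<integral>y. F y \<partial>\<mu>) \<le> (\<integral>y. b * M y \<partial>\<mu>)"
    by (intro integral_mono integrable_mult_right int conjunct1[OF FM] conjunct2[OF FM])+
  then have le: "a * (\<integral>y. M y \<partial>\<mu>) \<le> (\<integral>y. F y \<partial>\<mu>)" "(\<integral>y. F y \<partial>\<mu>) \<le> b * (\<integral>y. M y \<partial>\<mu>)"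
    by simp_all
  have M_pos: "AE y in \<mu>. 0 < M y"
    using \<mu>'(1) killed_pos[OF time_0 st] by (auto simp: M_def elim!: eventually_mono)
  \<comment> \<open>A nonnegative function with vanishing integral vanishes almost everywhere, while
    \<open>M\<close> is positive almost everywhere under the probability measure
    \<open>\<mu>\<close>.\<close>
  have "(\<integral>y. M y \<partial>\<mu>) \<noteq> 0"
  proof
    assume "(\<integral>y. M y \<partial>\<mu>) = 0"
    then have "AE y in \<mu>. M y = 0"
      using int by (subst (asm) integral_nonneg_eq_0_iff_AE) (auto simp: M_def)
    with M_pos have "AE y in \<mu>. False" by eventually_elim simp
    then show False by simp
  qed
  moreover have "0 \<le> (\<integral>y. M y \<partial>\<mu>)" by (simp add: M_def)
  ultimately have pos: "0 < (\<integral>y. M y \<partial>\<mu>)" by simp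
  have surv: "survival (law_from 0 \<mu>) (tau 0) (s + t) = (\<integral>y. M y \<partial>\<mu>)"
    using survival_law_from[OF time_0 st \<mu>'(5)] by (simp add: M_def)
  have "(\<integral>z. f z \<partial>cond_law (law_from 0 \<mu>) (tau 0) (s + t)) = (\<integral>y. F y \<partial>\<mu>) / (\<integral>y. M y \<partial>\<mu>)"
    using integral_cond_law[OF prob_space_law_from(2)[OF time_0 \<mu>'(5)] L.finite_measure_axioms st _ f(1)]
      tau_event[OF time_0 st] surv pos integral_killed_law_from[OF time_0 st \<mu>'(5) f]
    by (simp add: F_def)
  moreover have "a \<le> (\<integral>y. F y \<partial>\<mu>) / (\<integral>y. M y \<partial>\<mu>)" "(\<integral>y. F y \<partial>\<mu>) / (\<integral>y. M y \<partial>\<mu>) \<le> b"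
    using le pos by (simp_all add: field_simps)
  moreover have "a \<le> (\<integral>z. f z \<partial>killed s t x) / measure (killed s t x) (space E)"
    "(\<integral>z. f z \<partial>killed s t x) / measure (killed s t x) (space E) \<le> b"
    using ab[OF x] killed_pos[OF s t x] by (simp_all add: field_simps)
  ultimately show ?thesis by linarith
qed

section \<open>Comparison with the limiting boundary\<close>

lemma A_inf_subset: "t \<in> I \<Longrightarrow> A_inf \<subseteq> A t"
  by (auto simp: A_inf_def)

lemma clock_less_tau_inf: "s \<in> I \<Longrightarrow> ereal t < clock s \<omega> \<Longrightarrow> ereal t < tau_inf \<omega>"
  unfolding clock_def tau_inf_def less_hit_from_iff by (meson A_inf_subset subsetD time_add)

text \<open>Hitting \<open>A_inf\<close> entails hitting the moving boundary, so
  \<open>killed s t x\<close> is setwise below \<open>killed_inf t x\<close>. Monotonicity applied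
  to the nonnegative functions \<open>1 + f\<close> and \<open>1 - f\<close> yields the two signs of
  the bound.\<close>

lemma killed_inf_diff:
  fixes f :: "'e \<Rightarrow> real"
  assumes s: "s \<in> I" and t: "t \<in> I" and f: "f \<in> borel_measurable E" "\<And>x. \<bar>f x\<bar> \<le> 1"
  shows "\<bar>(\<integral>z. f z \<partial>killed s t x) - (\<integral>z. f z \<partial>killed_inf t x)\<bar>
    \<le> measure (killed_inf t x) (space E) - measure (killed s t x) (space E)"
proof -
  interpret K: subprob_space "killed s t x" by (rule killed_subprob[OF s t])
  interpret K': subprob_space "killed_inf t x" by (rule killed_inf_subprob[OF t])
  interpret PS: prob_space "P 0 x" by (rule prob_space_P[OF time_0])
  have le: "1 * measure (killed s t x) B \<le> measure (killed_inf t x) B" if "B \<in> sets (killed s t x)" for B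
  proof -
    have B: "B \<in> sets E" using that by simp
    have "emeasure (killed s t x) B = emeasure (P 0 x) {\<omega> \<in> \<Omega>. ereal t < clock s \<omega> \<and> X t \<omega> \<in> B}"
      unfolding killed_def by (rule emeasure_killed_law[OF sets_P[OF time_0] t clock_event(2)[OF s] B])
    also have "\<dots> \<le> emeasure (P 0 x) {\<omega> \<in> \<Omega>. ereal t < tau_inf \<omega> \<and> X t \<omega> \<in> B}"
      using killed_event_measurable[OF t tau_inf_event B] clock_less_tau_inf[OF s]
      by (intro emeasure_mono) auto
    also have "\<dots> = emeasure (killed_inf t x) B"
      unfolding killed_inf_def by (rule emeasure_killed_law[OF sets_P[OF time_0] t tau_inf_event B, symmetric])
    finally show ?thesis by (simp add: K.emeasure_eq_measure K'.emeasure_eq_measure)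
  qed
  have int: "integrable (killed s t x) f" "integrable (killed_inf t x) f"
    using f by (auto intro!: K.integrable_const_bound[of _ 1] K'.integrable_const_bound[of _ 1])
  have f1: "\<bar>1 + f y\<bar> \<le> 2" "\<bar>1 - f y\<bar> \<le> 2" "0 \<le> 1 + f y" "0 \<le> 1 - f y" for y
    using f(2)[of y] by auto
  have "1 * (\<integral>z. 1 + f z \<partial>killed s t x) \<le> (\<integral>z. 1 + f z \<partial>killed_inf t x)"
    "1 * (\<integral>z. 1 - f z \<partial>killed s t x) \<le> (\<integral>z. 1 - f z \<partial>killed_inf t x)"
    using f1 f(1)
    by (intro minorized_integral[OF K'.finite_measure_axioms K.finite_measure_axioms _ _ le, of _ 2]; simp)+
  then show ?thesis using int by simp
qed


text \<open>A real supremum dominates its members only when the set is bounded above; for two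
  probability measures 2 is such a bound.\<close>

lemma tv_dist_upper:
  fixes f :: "'e \<Rightarrow> real"
  assumes "prob_space \<mu>" "prob_space \<nu>" "sets \<mu> = sets E" "sets \<nu> = sets E"
    and "f \<in> borel_measurable E" "\<And>x. \<bar>f x\<bar> \<le> 1"
  shows "\<bar>(\<integral>x. f x \<partial>\<mu>) - (\<integral>x. f x \<partial>\<nu>)\<bar> \<le> tv_dist E \<mu> \<nu>"
  unfolding tv_dist_def
proof (rule cSUP_upper)
  interpret M: prob_space \<mu> by fact
  interpret N: prob_space \<nu> by fact
  have bound: "\<bar>(\<integral>x. g x \<partial>\<mu>) - (\<integral>x. g x \<partial>\<nu>)\<bar> \<le> 2"
    if g: "g \<in> borel_measurable E" "\<And>x. \<bar>g x\<bar> \<le> 1" for g :: "'e \<Rightarrow> real"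
  proof -
    have [measurable]: "g \<in> borel_measurable \<mu>" "g \<in> borel_measurable \<nu>"
      using g assms by (simp_all cong: measurable_cong_sets)
    have "\<bar>\<integral>x. g x \<partial>\<mu>\<bar> \<le> (\<integral>x. \<bar>g x\<bar> \<partial>\<mu>)" "\<bar>\<integral>x. g x \<partial>\<nu>\<bar> \<le> (\<integral>x. \<bar>g x\<bar> \<partial>\<nu>)"
      by (rule integral_abs_bound)+
    moreover have "(\<integral>x. \<bar>g x\<bar> \<partial>\<mu>) \<le> 1" "(\<integral>x. \<bar>g x\<bar> \<partial>\<nu>) \<le> 1"
      using g by (intro M.integral_le_const N.integral_le_const M.integrable_const_bound[of _ 1]
        N.integrable_const_bound[of _ 1]; simp)+
    ultimately show ?thesis by linarith
  qed
  show "bdd_above ((\<lambda>f :: 'e \<Rightarrow> real. \<bar>(\<integral>x. f x \<partial>\<mu>) - (\<integral>x. f x \<partial>\<nu>)\<bar>) ` {f \<in> borel_measurable E. \<forall>x\<in>space E. \<bar>f x\<bar> \<le> 1})"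
    by (rule bdd_aboveI2[where M = 2]) (use bound in \<open>auto simp: space_E\<close>)
qed (use assms in auto)

text \<open>The uniform estimate is applied to the point mass at \<open>x\<close>, for which
  \<open>law_from 0\<close> gives back \<open>P 0 x\<close>, and the conditional expectation is then
  written as a quotient of killed quantities.\<close>

lemma cond_law_inf:
  fixes f :: "'e \<Rightarrow> real"
  assumes bound: "\<forall>\<mu>\<in>prob_on E alive_inf. \<forall>t\<in>I. tv_dist E (cond_law (law_from 0 \<mu>) tau_inf t) \<alpha> \<le> C * exp (- \<gamma> * t)"
    and \<alpha>: "\<alpha> \<in> prob_on E alive_inf" and x: "x \<in> alive_inf" and t: "t \<in> I"
    and pos: "0 < measure (killed_inf t x) (space E)"
    and f: "f \<in> borel_measurable E" "\<And>x. \<bar>f x\<bar> \<le> 1"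
  shows "\<bar>(\<integral>z. f z \<partial>killed_inf t x) / measure (killed_inf t x) (space E) - (\<integral>z. f z \<partial>\<alpha>)\<bar> \<le> C * exp (- \<gamma> * t)"
proof -
  interpret PS: prob_space "P 0 x" by (rule prob_space_P[OF time_0])
  have \<alpha>': "sets \<alpha> = sets E" "prob_space \<alpha>" "emeasure \<alpha> alive_inf = 1"
    using \<alpha> by (auto simp: prob_on_def space_prob_algebra)
  \<comment> \<open>Measurability is again forced by full mass; it is needed to evaluate the point
    mass on \<open>alive_inf\<close>.\<close>
  then have "alive_inf \<in> sets E" using emeasure_neq_0_sets[of \<alpha> alive_inf] by simp
  then have ret: "return E x \<in> prob_on E alive_inf"
    using x by (auto simp: prob_on_def space_prob_algebra space_E intro!: prob_space_return)
  have law: "law_from 0 (return E x) = P 0 x"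
    unfolding law_from_def by (rule bind_return[OF kernel_0_measurable]) (simp add: space_E)
  have surv: "survival (P 0 x) tau_inf t = measure (killed_inf t x) (space E)"
    unfolding killed_inf_def by (rule survival_eq_killed_law[OF sets_P[OF time_0] t tau_inf_event])
  note cond = sets_P[OF time_0] PS.finite_measure_axioms t tau_inf_event
  have "prob_space (cond_law (P 0 x) tau_inf t)"
    by (rule prob_space_cond_law[OF cond]) (simp add: surv pos)
  then have "\<bar>(\<integral>z. f z \<partial>cond_law (P 0 x) tau_inf t) - (\<integral>z. f z \<partial>\<alpha>)\<bar> \<le> tv_dist E (cond_law (P 0 x) tau_inf t) \<alpha>"
    using \<alpha>' f by (intro tv_dist_upper) (auto simp: cond_law_def)
  also have "\<dots> \<le> C * exp (- \<gamma> * t)" using bound ret t law by metis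
  finally show ?thesis
    using integral_cond_law[OF cond f(1)] pos by (simp add: surv killed_inf_def)
qed

text \<open>Part (b) of \<open>H_hom\<close> is convergence of the masses; by
  \<open>killed_inf_diff\<close> the difference of masses dominates that of the integrals, which
  gives their convergence.\<close>

lemma killed_tendsto_killed_inf:
  fixes f :: "'e \<Rightarrow> real"
  assumes H: H_hom and x: "x \<in> alive 0" and t: "t \<in> I"
    and f: "f \<in> borel_measurable E" "\<And>x. \<bar>f x\<bar> \<le> 1"
  shows "((\<lambda>s. \<integral>z. f z \<partial>killed s t x) \<longlongrightarrow> (\<integral>z. f z \<partial>killed_inf t x)) to_infinity"
    and "((\<lambda>s. measure (killed s t x) (space E)) \<longlongrightarrow> measure (killed_inf t x) (space E)) to_infinity"
proof -
  \<comment> \<open>The filter sees only times in \<open>I\<close>, where survival probabilities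
    agree with masses of killed laws.\<close>
  have ev: "eventually (\<lambda>s. s \<in> I) to_infinity" by (auto simp: eventually_to_infinity)
  have "((\<lambda>s. survival (P s x) (tau s) (s + t)) \<longlongrightarrow> survival (P 0 x) tau_inf t) to_infinity"
    using H x t by (simp add: H_hom_def)
  moreover have "survival (P 0 x) tau_inf t = measure (killed_inf t x) (space E)"
    unfolding killed_inf_def by (rule survival_eq_killed_law[OF sets_P[OF time_0] t tau_inf_event])
  ultimately show lim: "((\<lambda>s. measure (killed s t x) (space E)) \<longlongrightarrow> measure (killed_inf t x) (space E)) to_infinity"
    using Lim_transform_eventually[where g = "\<lambda>s. measure (killed s t x) (space E)", OF _ eventually_mono[OF ev]]
    by (simp add: survival_killed t)
  have "((\<lambda>s. measure (killed_inf t x) (space E) - measure (killed s t x) (space E)) \<longlongrightarrow> 0) to_infinity"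
    using tendsto_diff[OF tendsto_const[of "measure (killed_inf t x) (space E)"] lim] by simp
  then have "((\<lambda>s. (\<integral>z. f z \<partial>killed s t x) - (\<integral>z. f z \<partial>killed_inf t x)) \<longlongrightarrow> 0) to_infinity"
    by (rule Lim_null_comparison[rotated]) (use ev killed_inf_diff[OF _ t f] in \<open>auto elim!: eventually_mono\<close>)
  then show "((\<lambda>s. \<integral>z. f z \<partial>killed s t x) \<longlongrightarrow> (\<integral>z. f z \<partial>killed_inf t x)) to_infinity"
    by (simp add: LIM_zero_iff)
qed

section \<open>Convergence of the conditional laws\<close>

lemma cond_law_tendsto:
  fixes f :: "'e \<Rightarrow> real"
  assumes mono: "\<And>s t. s \<in> I \<Longrightarrow> t \<in> I \<Longrightarrow> s \<le> t \<Longrightarrow> A t \<subseteq> A s"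
    and A': assumption_A' and H: H_hom and \<alpha>: "exp_attracting \<alpha>" and \<mu>: "\<mu> \<in> prob_on E (alive 0)"
    and f: "f \<in> borel_measurable E" "\<And>x. \<bar>f x\<bar> \<le> 1"
  shows "((\<lambda>t. \<integral>z. f z \<partial>cond_law (law_from 0 \<mu>) (tau 0) t) \<longlongrightarrow> (\<integral>z. f z \<partial>\<alpha>)) to_infinity"
proof -
  obtain \<nu> t0 c1 c2 where "(\<forall>s\<in>I. \<nu> s \<in> prob_on E (alive s)) \<and> t0 \<in> I \<and> 0 < t0 \<and> 0 < c1 \<and> 0 < c2 \<and>
      (\<forall>s\<in>I. \<forall>x\<in>alive s. \<forall>B\<in>sets E.
         c1 * measure (\<nu> (s + t0)) B \<le> measure (cond_law (P s x) (tau s) (s + t0)) B) \<and>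
      (\<forall>s\<in>I. \<forall>t\<in>I. s \<le> t \<longrightarrow> (\<forall>x\<in>alive s.
         c2 * survival (P s x) (tau s) t \<le> survival (law_from s (\<nu> s)) (tau s) t))"
    using A' unfolding assumption_A'_def by metis
  then have \<nu>: "\<And>s. s \<in> I \<Longrightarrow> \<nu> s \<in> prob_on E (alive s)"
    and t0: "t0 \<in> I" "0 < t0" and c: "0 < c1" "0 < c2"
    and minor: "\<And>s x B. s \<in> I \<Longrightarrow> x \<in> alive s \<Longrightarrow> B \<in> sets E \<Longrightarrow>
         c1 * measure (\<nu> (s + t0)) B \<le> measure (cond_law (P s x) (tau s) (s + t0)) B"
    and dominated: "\<And>s t x. s \<in> I \<Longrightarrow> t \<in> I \<Longrightarrow> s \<le> t \<Longrightarrow> x \<in> alive s \<Longrightarrow>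
         c2 * survival (P s x) (tau s) t \<le> survival (law_from s (\<nu> s)) (tau s) t"
    by simp_all
  \<comment> \<open>Lowering \<open>c2\<close> keeps the contraction factor nonnegative.\<close>
  define d where "d = min c2 (1 / (2 * c1))"
  have d: "0 < d" "d \<le> c2" "c1 * d \<le> 1 / 2"
    using c by (auto simp: d_def min_def field_simps)
  then have d1: "c1 * d \<le> 1" by simp
  have dominated': "d * survival (P s x) (tau s) t \<le> survival (law_from s (\<nu> s)) (tau s) t"
    if "s \<in> I" "t \<in> I" "s \<le> t" "x \<in> alive s" for s t x
    using dominated[OF that] mult_right_mono[OF d(2), of "survival (P s x) (tau s) t"]
    by (auto simp: survival_def)
  obtain C \<gamma> where C: "0 < C" "0 < \<gamma>"
    and bound: "\<forall>\<mu>\<in>prob_on E alive_inf. \<forall>t\<in>I. tv_dist E (cond_law (law_from 0 \<mu>) tau_inf t) \<alpha> \<le> C * exp (- \<gamma> * t)"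
    and \<alpha>': "\<alpha> \<in> prob_on E alive_inf"
    using \<alpha> unfolding exp_attracting_def by blast
  obtain x where x: "x \<in> alive 0" using prob_on_aliveD(4)[OF \<mu>] by blast
  \<comment> \<open>Here the boundary being non-increasing enters: one point alive at time 0 serves
    as reference starting point at every time \<open>s\<close>.\<close>
  have x_alive: "x \<in> alive s" if "s \<in> I" for s
    using x mono[OF time_0 that time_nonneg[OF that]] by (auto simp: alive_def)
  have x_inf: "x \<in> alive_inf"
    using x A_inf_subset[OF time_0] by (auto simp: alive_def alive_inf_def)
  show ?thesis
  proof (rule tendstoI)
    fix e :: real assume e: "0 < e"
    have "(\<lambda>n. 2 * (1 - c1 * d) ^ n + C * exp (- \<gamma> * (real n * t0))) \<longlonglongrightarrow> 2 * 0 + C * 0"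
    proof (intro tendsto_add tendsto_mult tendsto_const)
      show "(\<lambda>n. (1 - c1 * d) ^ n) \<longlonglongrightarrow> 0"
        using d c by (intro LIMSEQ_power_zero) auto
      have "(\<lambda>n. exp (- \<gamma> * t0) ^ n) \<longlonglongrightarrow> 0"
        using C t0 by (intro LIMSEQ_power_zero) auto
      then show "(\<lambda>n. exp (- \<gamma> * (real n * t0))) \<longlonglongrightarrow> 0"
        by (simp add: exp_of_nat_mult[symmetric] mult_ac)
    qed
    \<comment> \<open>\<open>n\<close> is fixed first, bringing the contraction error and the
      exponential error together below \<open>e / 2\<close>. The rest is left for the limit in
      \<open>s\<close>, whose threshold \<open>s0\<close> may depend on \<open>n\<close>.\<close>
    then have "eventually (\<lambda>n. 2 * (1 - c1 * d) ^ n + C * exp (- \<gamma> * (real n * t0)) < e / 2) sequentially"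
      using e by (intro order_tendstoD(2)) auto
    then obtain n where n: "2 * (1 - c1 * d) ^ n + C * exp (- \<gamma> * (real n * t0)) < e / 2"
      unfolding eventually_sequentially by blast
    define T where "T = real n * t0"
    have T: "T \<in> I" unfolding T_def by (rule time_of_nat_mult[OF t0(1)])
    let ?r = "\<lambda>s. (\<integral>z. f z \<partial>killed s T x) / measure (killed s T x) (space E)"
    let ?R = "(\<integral>z. f z \<partial>killed_inf T x) / measure (killed_inf T x) (space E)"
    \<comment> \<open>The mass killed at \<open>A_inf\<close> is at least the mass killed at the
      moving boundary, which is positive; this permits passing to the limit in the quotient.\<close>
    have pos: "0 < measure (killed_inf T x) (space E)"
      using killed_inf_diff[OF time_0 T f, of x] killed_pos[OF time_0 T x] by linarith
    have "(?r \<longlongrightarrow> ?R) to_infinity"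
      using pos by (intro tendsto_divide killed_tendsto_killed_inf[OF H x T f]) auto
    then have "eventually (\<lambda>s. dist (?r s) ?R < e / 2) to_infinity"
      using e by (intro tendstoD) auto
    then obtain s0 where s0: "\<And>s. s \<in> I \<Longrightarrow> s0 \<le> s \<Longrightarrow> dist (?r s) ?R < e / 2"
      unfolding eventually_to_infinity by blast
    \<comment> \<open>The last \<open>T\<close> units of time are used for mixing, so the restart
      takes place at \<open>t - T\<close>; the lower bound on \<open>t\<close> makes this a time in
      \<open>I\<close> beyond \<open>s0\<close>.\<close>
    have "dist (\<integral>z. f z \<partial>cond_law (law_from 0 \<mu>) (tau 0) t) (\<integral>z. f z \<partial>\<alpha>) < e"
      if t: "t \<in> I" "max T (s0 + T) \<le> t" for t
    proof -
      have s: "t - T \<in> I" "s0 \<le> t - T" using t T by (auto intro: time_diff)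
      have tT: "(t - T) + T = t" by simp
      have "\<exists>a b. b - a \<le> 2 * (1 - c1 * d) ^ n \<and>
        (\<forall>y\<in>alive (t - T). a * measure (killed (t - T) T y) (space E) \<le> (\<integral>z. f z \<partial>killed (t - T) T y) \<and>
          (\<integral>z. f z \<partial>killed (t - T) T y) \<le> b * measure (killed (t - T) T y) (space E))"
        unfolding T_def
        by (rule oscillation_contraction[OF _ t0(1) c(1) d(1) d1 minor dominated' f s(1)[unfolded T_def]]) (rule \<nu>)
      then obtain a b where ab: "b - a \<le> 2 * (1 - c1 * d) ^ n"
        "\<forall>y\<in>alive (t - T). a * measure (killed (t - T) T y) (space E) \<le> (\<integral>z. f z \<partial>killed (t - T) T y) \<and>
          (\<integral>z. f z \<partial>killed (t - T) T y) \<le> b * measure (killed (t - T) T y) (space E)"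
        by blast
      have "\<bar>(\<integral>z. f z \<partial>cond_law (law_from 0 \<mu>) (tau 0) ((t - T) + T)) - ?r (t - T)\<bar> \<le> b - a"
        using ab(2) by (intro cond_law_merge[OF \<mu> s(1) T x_alive[OF s(1)] f]) auto
      then have "\<bar>(\<integral>z. f z \<partial>cond_law (law_from 0 \<mu>) (tau 0) t) - ?r (t - T)\<bar> \<le> b - a"
        unfolding tT .
      moreover have "\<bar>?R - (\<integral>z. f z \<partial>\<alpha>)\<bar> \<le> C * exp (- \<gamma> * T)"
        by (rule cond_law_inf[OF bound \<alpha>' x_inf T pos f])
      ultimately show ?thesis
        using s0[OF s] ab(1) n unfolding dist_real_def T_def[symmetric] by linarith
    qed
    then show "eventually (\<lambda>t. dist (\<integral>z. f z \<partial>cond_law (law_from 0 \<mu>) (tau 0) t) (\<integral>z. f z \<partial>\<alpha>) < e) to_infinity"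
      unfolding eventually_to_infinity by blast
  qed
qed

lemma cond_law_weakly_converges:
  assumes "\<And>s t. s \<in> I \<Longrightarrow> t \<in> I \<Longrightarrow> s \<le> t \<Longrightarrow> A t \<subseteq> A s"
    and assumption_A' H_hom "exp_attracting \<alpha>" "\<mu> \<in> prob_on E (alive 0)"
  shows "weakly_converges E (cond_law (law_from 0 \<mu>) (tau 0)) \<alpha> to_infinity"
  unfolding weakly_converges_def
proof safe
  fix f :: "'e \<Rightarrow> real"
  assume "bounded (range f)" and f: "f \<in> borel_measurable E"
  then obtain b where b: "b > 0" "\<And>x. \<bar>f x\<bar> \<le> b"
    unfolding bounded_pos by auto
  \<comment> \<open>Dividing by the bound \<open>b\<close> brings the test function into the unit
    ball required by \<open>cond_law_tendsto\<close>.\<close>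
  have "((\<lambda>t. b * (\<integral>x. f x / b \<partial>cond_law (law_from 0 \<mu>) (tau 0) t)) \<longlongrightarrow> b * (\<integral>x. f x / b \<partial>\<alpha>)) to_infinity"
    using f b by (intro tendsto_mult tendsto_const cond_law_tendsto[OF assms]) (auto simp: field_simps)
  then show "((\<lambda>t. \<integral>x. f x \<partial>cond_law (law_from 0 \<mu>) (tau 0) t) \<longlongrightarrow> (\<integral>x. f x \<partial>\<alpha>)) to_infinity"
    using b by simp
qed

end

theorem theorem3:
  fixes I :: "real set"
    and E :: "'e::metric_space measure"
    and \<Omega> :: "'w set"
    and X :: "real \<Rightarrow> 'w \<Rightarrow> 'e"
    and P :: "real \<Rightarrow> 'e \<Rightarrow> 'w measure"
    and A :: "real \<Rightarrow> 'e set"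
    and \<alpha> \<mu> :: "'e measure"
  assumes "moving_boundary_process I E \<Omega> X P A"
    and "\<And>s t. s \<in> I \<Longrightarrow> t \<in> I \<Longrightarrow> s \<le> t \<Longrightarrow> A t \<subseteq> A s"
    and "boundary_basics.A_inf I A \<noteq> {}"
    and "boundary_basics.assumption_A' I E \<Omega> X P A"
    and "boundary_basics.H_hom I E \<Omega> X P A"
    and "boundary_basics.H_inf I E \<Omega> X P A \<alpha>"
    and "boundary_basics.H_inf' I E \<Omega> X P A \<alpha>"
    and "\<mu> \<in> prob_on E (boundary_basics.alive E A 0)"
  shows "weakly_converges E
    (process_basics.cond_law E \<Omega> X (process_basics.law_from P 0 \<mu>) (boundary_basics.tau I X A 0))
    \<alpha> (process_basics.to_infinity I)"
proof -
  interpret moving_boundary_process I E \<Omega> X P A by fact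
  have "exp_attracting \<alpha>" using assms(6) by (simp add: H_inf_def)
  with assms(2,4,5,8) show ?thesis by (intro cond_law_weakly_converges)
qed

end
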